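(* Let $\Bbbk$ be an algebraically closed field, $n\geq1$, $d_1\geq1$, $d_2\geq0$ integers, and let $S=\Bbbk_{dp}[x_1,\ldots,x_n]\subseteq T=\Bbbk_{dp}[x_0,\ldots,x_n]$. Let $W\subseteq S_{\leq d_1}$ be a nonzero linear subspace and $r=\dim_{\Bbbk}S^*/\operatorname{Ann}(W)$. Then: (i) The cactus rank of $W^{hom,d_2}$ is not greater than $r$. (ii) If $d_2\geq d_1$, then there is no homogeneous ideal $J\subseteq\operatorname{Ann}(W^{hom,d_2})\subseteq T^*$ such that $T^*/J$ has an $(r-1,n+1)$-standard Hilbert function. In particular, the border cactus rank of $W^{hom,d_2}$ equals $r$. (iii) If $d_2\geq d_1+1$ and $J\subseteq\operatorname{Ann}(W^{hom,d_2})$ is a homogeneous ideal such that $T^*/J$ has an $(r,n+1)$-standard Hilbert function, then $J^{sat}=\operatorname{Ann}(W)^{hom}$.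
   Context: Divided powers: $T^*=\Bbbk[\alpha_0,\ldots,\alpha_n]$ and $S^*=\Bbbk[\alpha_1,\ldots,\alpha_n]$ are polynomial rings; $T=\Bbbk_{dp}[x_0,\ldots,x_n]\supseteq S=\Bbbk_{dp}[x_1,\ldots,x_n]$ are their graded dual (divided power) rings, with $\Bbbk$-basis the divided power monomials $x^{[\mathbf v]}$. $T^*$ acts on $T$ (and $S^*$ on $S$) by contraction: $\alpha^{\mathbf u}\lrcorner x^{[\mathbf v]}=x^{[\mathbf v-\mathbf u]}$ if $v_k\geq u_k$ for all $k$, and $0$ otherwise. For a linear form $L=\sum a_ix_i$, $L^{[d]}=\sum_{|\mathbf u|=d}a^{\mathbf u}x^{[\mathbf u]}$. For a subspace $V$ of $S$ (resp. of $T$), $\operatorname{Ann}(V)$ is the ideal of all $\theta$ in $S^*$ (resp. $T^*$) with $\theta\lrcorner V=0$; $\operatorname{Ann}(W)\subseteq S^*$, $\operatorname{Ann}(W^{hom,d_2})\subseteq T^*$. Homogenization: $W^{hom,d_2}=\left\{\sum_iF_i\,x_0^{[d_1+d_2-i]}\;\middle|\;\sum_iF_i\in W,\ F_i\in S_i\right\}\subseteq T_{d_1+d_2}$. For an ideal $I\subseteq S^*$, $I^{hom}\subseteq T^*$ is its homogenization with respect to $\alpha_0$ (the ideal generated by the homogenizations of all elements of $I$). $J^{sat}$ is the saturation of $J$ with respect to $(\alpha_0,\ldots,\alpha_n)$. Standard Hilbert functions: $h:\mathbb{Z}_{\geq0}\to\mathbb{Z}_{\geq0}$ is $(s,n+1)$-standard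 if (a) $h(e)\leq h(e+1)$ for all $e$; (b) if $h(e)=h(e+1)$ then $h(e')=s$ for all $e'\geq e$; (c) $0\leq h(e)\leq\min\{\dim_{\Bbbk}T^*_e,s\}$ for all $e$. Ranks: let $\nu_d:\mathbb{P}T_1\to\mathbb{P}T_d$, $[L]\mapsto[L^{[d]}]$ ($\mathbb{P}$ = lines through $0$). The cactus rank of a $k$-dimensional subspace $V\subseteq T_d$ ($k\geq1$) is the least $r\in\mathbb{Z}_{>0}$ such that $\mathbb{P}V\subseteq\langle\nu_d(R)\rangle$ for some zero-dimensional subscheme $R\subseteq\mathbb{P}T_1$ of length $r$ ($\langle\cdot\rangle$ is the projective linear span of a scheme). The Grassmann cactus variety $\kappa_{r,k}(\nu_d(\mathbb{P}T_1))$ is the Zariski closure in the Grassmannian $\operatorname{Gr}(k,T_d)$ of the set of $[V]$ of cactus rank at most $r$. The border cactus rank of $V$ is the least $r\in\mathbb{Z}_{>0}$ with $[V]\in\kappa_{r,k}(\nu_d(\mathbb{P}T_1))$. *)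

theory Defs
  imports
    "HOL-Library.Poly_Mapping"
    "HOL-Library.Extended_Nat"
    "HOL-Computational_Algebra.Polynomial"
    "Jordan_Normal_Form.Determinant"
begin

text \<open>
  Both the polynomial ring with variables indexed by \<open>'i\<close> and its graded dual, the divided power
  ring, are finitely supported functions on exponent vectors: an element of \<open>('i, 'k) mpoly\<close> is
  \<open>\<Sum>\<^sub>u c\<^sub>u \<alpha>\<^bsup>u\<^esup>\<close> and an element of \<open>('i, 'k) dpoly\<close> is \<open>\<Sum>\<^sub>v c\<^sub>v x\<^bsup>[v]\<^esup>\<close>.  The type class product
  of \<open>'a \<Rightarrow>\<^sub>0 'b\<close> is the one of the polynomial ring; the product of the divided power ring
  is \<open>dp_mult\<close> below.

  The variables of \<open>S\<close> and \<open>S\<^sup>*\<close> are indexed by a finite type \<open>'n\<close> (so \<open>n = CARD('n) \<ge> 1\<close>),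
  those of \<open>T\<close> and \<open>T\<^sup>*\<close> by \<open>'n option\<close>, where \<open>None\<close> is the index of \<open>x\<^sub>0\<close> and \<open>\<alpha>\<^sub>0\<close>.
\<close>

type_synonym 'i expo = "'i \<Rightarrow>\<^sub>0 nat"
type_synonym ('i, 'k) mpoly = "'i expo \<Rightarrow>\<^sub>0 'k"
type_synonym ('i, 'k) dpoly = "'i expo \<Rightarrow>\<^sub>0 'k"

abbreviation coef :: "('a \<Rightarrow>\<^sub>0 'b) \<Rightarrow> 'a \<Rightarrow> 'b::zero" where
  "coef \<equiv> Poly_Mapping.lookup"

definition mdeg :: "'i expo \<Rightarrow> nat" where
  "mdeg u = (\<Sum>i\<in>Poly_Mapping.keys u. coef u i)"

definition monom_val :: "('i \<Rightarrow> 'k::comm_ring_1) \<Rightarrow> 'i expo \<Rightarrow> 'k" where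
  "monom_val a u = (\<Prod>i\<in>Poly_Mapping.keys u. a i ^ coef u i)"

definition mpoly_eval :: "('i, 'k::comm_ring_1) mpoly \<Rightarrow> ('i \<Rightarrow> 'k) \<Rightarrow> 'k" where
  "mpoly_eval p a = (\<Sum>u\<in>Poly_Mapping.keys p. coef p u * monom_val a u)"

definition mvar :: "'i \<Rightarrow> ('i, 'k::comm_ring_1) mpoly" where
  "mvar i = Poly_Mapping.single (Poly_Mapping.single i 1) 1"


subsection \<open>Vector space structure, gradings, quotient dimensions\<close>

definition pscale :: "'k::field \<Rightarrow> ('a \<Rightarrow>\<^sub>0 'k) \<Rightarrow> ('a \<Rightarrow>\<^sub>0 'k)" where
  "pscale c p = Poly_Mapping.map ((*) c) p"

lemma lookup_pscale: "coef (pscale c p) u = c * coef p u"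
  by (simp add: pscale_def Poly_Mapping.map.rep_eq when_def)

global_interpretation pm: vector_space pscale
  by unfold_locales
    (auto intro!: poly_mapping_eqI simp: lookup_pscale lookup_add algebra_simps)

definition homog_part :: "nat \<Rightarrow> ('i expo \<Rightarrow>\<^sub>0 'k::zero) set" where
  "homog_part e = {f. \<forall>u\<in>Poly_Mapping.keys f. mdeg u = e}"

definition deg_le_part :: "nat \<Rightarrow> ('i expo \<Rightarrow>\<^sub>0 'k::zero) set" where
  "deg_le_part e = {f. \<forall>u\<in>Poly_Mapping.keys f. mdeg u \<le> e}"

definition hcomp :: "nat \<Rightarrow> ('i expo \<Rightarrow>\<^sub>0 'k::comm_monoid_add) \<Rightarrow> ('i expo \<Rightarrow>\<^sub>0 'k)" where
  "hcomp e f =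
    (\<Sum>u\<in>{u\<in>Poly_Mapping.keys f. mdeg u = e}. Poly_Mapping.single u (coef f u))"

definition total_deg :: "('i expo \<Rightarrow>\<^sub>0 'k::zero) \<Rightarrow> nat" where
  "total_deg f = Max (insert 0 (mdeg ` Poly_Mapping.keys f))"

text \<open>
  For subspaces \<open>B \<subseteq> A\<close>: the residue classes of the elements of \<open>C\<close> are pairwise distinct and form
  a basis of \<open>A/B\<close>.  As with the library's \<open>dim\<close>, the dimension of an infinite-dimensional
  quotient is \<open>0\<close> by convention.
\<close>

definition quotient_basis :: "('a \<Rightarrow>\<^sub>0 'k::field) set \<Rightarrow> ('a \<Rightarrow>\<^sub>0 'k) set \<Rightarrow> ('a \<Rightarrow>\<^sub>0 'k) set \<Rightarrow> bool" where
  "quotient_basis A B C \<longleftrightarrow>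
     C \<subseteq> A \<and> pm.independent C \<and> pm.span C \<inter> B = {0} \<and>
     (\<forall>a\<in>A. \<exists>c\<in>pm.span C. a - c \<in> B)"

definition quotient_dim :: "('a \<Rightarrow>\<^sub>0 'k::field) set \<Rightarrow> ('a \<Rightarrow>\<^sub>0 'k) set \<Rightarrow> nat" where
  "quotient_dim A B = card (SOME C. quotient_basis A B C)"


subsection \<open>Ideals of polynomial rings\<close>

text \<open>Ideals are the submodules of the ring regarded as a module over itself.\<close>

definition is_ideal :: "'a::comm_ring_1 set \<Rightarrow> bool" where
  "is_ideal I \<longleftrightarrow> module.subspace (*) I"

definition ideal_gen :: "'a::comm_ring_1 set \<Rightarrow> 'a set" where
  "ideal_gen X = module.span (*) X"

fun ideal_power :: "'a::comm_ring_1 set \<Rightarrow> nat \<Rightarrow> 'a set" where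
  "ideal_power I 0 = UNIV"
| "ideal_power I (Suc N) = ideal_gen {f * g | f g. f \<in> I \<and> g \<in> ideal_power I N}"

definition homogeneous_ideal :: "('i, 'k::comm_ring_1) mpoly set \<Rightarrow> bool" where
  "homogeneous_ideal J \<longleftrightarrow> is_ideal J \<and> (\<forall>f\<in>J. \<forall>e. hcomp e f \<in> J)"

definition irrelevant_ideal :: "('i, 'k::comm_ring_1) mpoly set" where
  "irrelevant_ideal = ideal_gen (range mvar)"

definition saturation :: "('i, 'k::comm_ring_1) mpoly set \<Rightarrow> ('i, 'k) mpoly set" where
  "saturation J = {f. \<exists>N. \<forall>g\<in>ideal_power irrelevant_ideal N. f * g \<in> J}"

text \<open>\<open>hilbert_fun J\<close> is the Hilbert function of the quotient of the polynomial ring by the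
  homogeneous ideal \<open>J\<close>.\<close>

definition hilbert_fun :: "('i, 'k::field) mpoly set \<Rightarrow> nat \<Rightarrow> nat" where
  "hilbert_fun J e = quotient_dim (homog_part e) (J \<inter> homog_part e)"

text \<open>\<open>(s, CARD('i))\<close>-standard functions; the two type arguments determine the polynomial ring
  whose graded pieces bound \<open>h\<close>.\<close>

definition standard_fun :: "'i::finite itself \<Rightarrow> 'k::field itself \<Rightarrow> nat \<Rightarrow> (nat \<Rightarrow> nat) \<Rightarrow> bool" where
  "standard_fun _ _ s h \<longleftrightarrow>
     (\<forall>e. h e \<le> h (e + 1)) \<and>
     (\<forall>e. h e = h (e + 1) \<longrightarrow> (\<forall>e'\<ge>e. h e' = s)) \<and>
     (\<forall>e. h e \<le> min (pm.dim (homog_part e :: ('i, 'k) mpoly set)) s)"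


subsection \<open>Divided powers and contraction\<close>

definition dp_mult :: "('i, 'k::comm_ring_1) dpoly \<Rightarrow> ('i, 'k) dpoly \<Rightarrow> ('i, 'k) dpoly" where
  "dp_mult F G =
     (\<Sum>u\<in>Poly_Mapping.keys F. \<Sum>v\<in>Poly_Mapping.keys G.
        Poly_Mapping.single (u + v)
          (of_nat (\<Prod>i\<in>Poly_Mapping.keys (u + v). (coef u i + coef v i) choose coef u i)
             * coef F u * coef G v))"

definition dp_var :: "'i \<Rightarrow> nat \<Rightarrow> ('i, 'k::comm_ring_1) dpoly" where
  "dp_var i j = Poly_Mapping.single (Poly_Mapping.single i j) 1"

definition contract :: "('i, 'k::comm_ring_1) mpoly \<Rightarrow> ('i, 'k) dpoly \<Rightarrow> ('i, 'k) dpoly"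
    (infixr \<open>\<lrcorner>\<close> 70) where
  "\<theta> \<lrcorner> F =
     (\<Sum>u\<in>Poly_Mapping.keys \<theta>. \<Sum>v\<in>Poly_Mapping.keys F.
        if \<forall>i. coef u i \<le> coef v i
        then Poly_Mapping.single (v - u) (coef \<theta> u * coef F v) else 0)"

definition Ann :: "('i, 'k::comm_ring_1) dpoly set \<Rightarrow> ('i, 'k) mpoly set" where
  "Ann V = {\<theta>. \<forall>F\<in>V. \<theta> \<lrcorner> F = 0}"


subsection \<open>Homogenization\<close>

definition expo_embed :: "'n expo \<Rightarrow> 'n option expo" where
  "expo_embed u = (\<Sum>i\<in>Poly_Mapping.keys u. Poly_Mapping.single (Some i) (coef u i))"

text \<open>The inclusions of \<open>S\<close> into \<open>T\<close> and of \<open>S\<^sup>*\<close> into \<open>T\<^sup>*\<close>.\<close>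

definition embed :: "('n expo \<Rightarrow>\<^sub>0 'k::comm_monoid_add) \<Rightarrow> ('n option expo \<Rightarrow>\<^sub>0 'k)" where
  "embed f = (\<Sum>u\<in>Poly_Mapping.keys f. Poly_Mapping.single (expo_embed u) (coef f u))"

definition space_hom ::
    "nat \<Rightarrow> nat \<Rightarrow> ('n, 'k::comm_ring_1) dpoly set \<Rightarrow> ('n option, 'k) dpoly set" where
  "space_hom d1 d2 W =
     {\<Sum>i\<le>d1. dp_mult (embed (F i)) (dp_var None (d1 + d2 - i)) | F.
        (\<forall>i. F i \<in> homog_part i) \<and> (\<Sum>i\<le>d1. F i) \<in> W}"

definition poly_hom :: "('n, 'k::comm_ring_1) mpoly \<Rightarrow> ('n option, 'k) mpoly" where
  "poly_hom f = (\<Sum>i\<le>total_deg f. embed (hcomp i f) * mvar None ^ (total_deg f - i))"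

definition ideal_hom :: "('n, 'k::comm_ring_1) mpoly set \<Rightarrow> ('n option, 'k) mpoly set" where
  "ideal_hom I = ideal_gen (poly_hom ` I)"


subsection \<open>Subschemes of projective space and the Veronese map\<close>

text \<open>
  Closed subschemes of the projective space \<open>\<P>T\<^sub>1\<close> correspond bijectively to saturated homogeneous
  ideals of its homogeneous coordinate ring \<open>T\<^sup>*\<close>, and are represented by them.  The dimension of a
  subscheme is the degree of its Hilbert polynomial, and the length of a zero-dimensional subscheme
  is the constant value of that polynomial; it is positive, since the empty scheme is excluded.
\<close>

definition zero_dim_scheme :: "nat \<Rightarrow> ('i::finite, 'k::field) mpoly set \<Rightarrow> bool" where
  "zero_dim_scheme r I \<longleftrightarrow>
     homogeneous_ideal I \<and> saturation I = I \<and>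
     0 < r \<and> (\<exists>e0. \<forall>e\<ge>e0. hilbert_fun I e = r)"

text \<open>The linear form with coefficients \<open>a\<close>, and the divided power \<open>L\<^bsup>[d]\<^esup>\<close> of a linear form.\<close>

definition lin_form :: "('i::finite \<Rightarrow> 'k::comm_ring_1) \<Rightarrow> ('i, 'k) dpoly" where
  "lin_form a = (\<Sum>i\<in>UNIV. Poly_Mapping.single (Poly_Mapping.single i 1) (a i))"

definition dp_power :: "nat \<Rightarrow> ('i::finite, 'k::comm_ring_1) dpoly \<Rightarrow> ('i, 'k) dpoly" where
  "dp_power d L =
     (\<Sum>u\<in>{u. mdeg u = d}.
        Poly_Mapping.single u (monom_val (\<lambda>i. coef L (Poly_Mapping.single i 1)) u))"

text \<open>
  The pullback of a linear form \<open>\<phi>\<close> on \<open>T\<^sub>d\<close> along \<open>\<nu>\<^sub>d : [L] \<mapsto> [L\<^bsup>[d]\<^esup>]\<close>, as an element of \<open>T\<^sup>*\<^sub>d\<close>;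
  see \<open>eval_veronese_pullback\<close>.
\<close>

definition veronese_pullback ::
    "nat \<Rightarrow> (('i::finite, 'k::field) dpoly \<Rightarrow> 'k) \<Rightarrow> ('i, 'k) mpoly" where
  "veronese_pullback d \<phi> =
     (\<Sum>u\<in>{u. mdeg u = d}. Poly_Mapping.single u (\<phi> (Poly_Mapping.single u 1)))"

lemma mpoly_eval_superset:
  assumes "finite A" "Poly_Mapping.keys p \<subseteq> A"
  shows "mpoly_eval p a = (\<Sum>u\<in>A. coef p u * monom_val a u)"
  unfolding mpoly_eval_def
  by (rule sum.mono_neutral_left) (use assms in \<open>auto simp: in_keys_iff\<close>)

lemma mpoly_eval_add: "mpoly_eval (p + q) a = mpoly_eval p a + mpoly_eval q a"
proof -
  let ?A = "Poly_Mapping.keys p \<union> Poly_Mapping.keys q"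
  have "Poly_Mapping.keys (p + q) \<subseteq> ?A" by (rule Poly_Mapping.keys_add)
  then show ?thesis
    by (simp add: mpoly_eval_superset[of ?A] lookup_add algebra_simps sum.distrib)
qed

lemma mpoly_eval_zero [simp]: "mpoly_eval 0 a = 0"
  by (simp add: mpoly_eval_def)

lemma mpoly_eval_single [simp]:
  "mpoly_eval (Poly_Mapping.single u c) a = c * monom_val a u"
  by (subst mpoly_eval_superset[of "{u}"]) auto

lemma mpoly_eval_sum: "mpoly_eval (\<Sum>x\<in>X. f x) a = (\<Sum>x\<in>X. mpoly_eval (f x) a)"
  by (induction X rule: infinite_finite_induct) (simp_all add: mpoly_eval_add)

lemma coef_lin_form: "coef (lin_form a) (Poly_Mapping.single i 1) = a i"
proof -
  have "coef (lin_form a) (Poly_Mapping.single i 1) = (\<Sum>j\<in>UNIV. if j = i then a j else 0)"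
    unfolding lin_form_def lookup_sum
  proof (rule sum.cong[OF refl])
    fix j
    have "Poly_Mapping.single j (1::nat) = Poly_Mapping.single i 1 \<longleftrightarrow> j = i"
      by (metis lookup_single_eq lookup_single_not_eq one_neq_zero)
    then show "coef (Poly_Mapping.single (Poly_Mapping.single j (1::nat)) (a j)) (Poly_Mapping.single i 1)
        = (if j = i then a j else 0)"
      by (simp add: lookup_single when_def)
  qed
  then show ?thesis by simp
qed

lemma eval_veronese_pullback:
  assumes "Vector_Spaces.linear pscale (*) \<phi>"
  shows "mpoly_eval (veronese_pullback d \<phi>) a = \<phi> (dp_power d (lin_form a))"
proof -
  interpret L: Vector_Spaces.linear pscale "(*)" \<phi> by fact
  have "\<phi> (Poly_Mapping.single u c) = c * \<phi> (Poly_Mapping.single u 1)" for u c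
  proof -
    have "Poly_Mapping.single u c = pscale c (Poly_Mapping.single u 1)"
      by (rule poly_mapping_eqI) (simp add: lookup_pscale lookup_single when_def)
    then show ?thesis by (simp add: L.scale)
  qed
  then show ?thesis
    unfolding veronese_pullback_def dp_power_def mpoly_eval_sum L.sum coef_lin_form
      mpoly_eval_single
    by (metis (no_types, lifting) mult.commute)
qed

text \<open>
  \<open>\<P>E\<close> contains the scheme \<open>\<nu>\<^sub>d(R)\<close>, where \<open>R\<close> has saturated ideal \<open>I\<close>, iff every linear form
  vanishing on \<open>E\<close> pulls back to an element of \<open>I\<close>.
\<close>

definition veronese_image_in ::
    "nat \<Rightarrow> ('i::finite, 'k::field) mpoly set \<Rightarrow> ('i, 'k) dpoly set \<Rightarrow> bool" where
  "veronese_image_in d I E \<longleftrightarrow>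
     (\<forall>\<phi>. Vector_Spaces.linear pscale (*) \<phi> \<and> (\<forall>F\<in>E. \<phi> F = 0) \<longrightarrow> veronese_pullback d \<phi> \<in> I)"

text \<open>The affine cone over the linear span of \<open>\<nu>\<^sub>d(R)\<close>.\<close>

definition veronese_span :: "nat \<Rightarrow> ('i::finite, 'k::field) mpoly set \<Rightarrow> ('i, 'k) dpoly set" where
  "veronese_span d I =
     \<Inter>{E. pm.subspace E \<and> E \<subseteq> homog_part d \<and> veronese_image_in d I E}"

definition cactus_rank :: "nat \<Rightarrow> ('i::finite, 'k::field) dpoly set \<Rightarrow> enat" where
  "cactus_rank d V =
     Inf {enat r | r. 0 < r \<and> (\<exists>I. zero_dim_scheme r I \<and> V \<subseteq> veronese_span d I)}"


subsection \<open>The Zariski topology of the Grassmannian and border cactus rank\<close>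

definition Gr :: "nat \<Rightarrow> nat \<Rightarrow> ('i, 'k::field) dpoly set set" where
  "Gr k d = {V. pm.subspace V \<and> V \<subseteq> homog_part d \<and> pm.dim V = k}"

definition basis_list :: "('a \<Rightarrow>\<^sub>0 'k::field) set \<Rightarrow> ('a \<Rightarrow>\<^sub>0 'k) list \<Rightarrow> bool" where
  "basis_list V b \<longleftrightarrow> distinct b \<and> pm.independent (set b) \<and> pm.span (set b) = V"

text \<open>
  Pluecker coordinates of the span of \<open>b\<close> with respect to the monomial basis, indexed by all lists
  of exponents of the same length as \<open>b\<close> (not only increasing ones, which changes the coordinates
  only by adding zeros and copies up to sign).
\<close>

definition pluecker :: "('a \<Rightarrow>\<^sub>0 'k::field) list \<Rightarrow> 'a list \<Rightarrow> 'k" where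
  "pluecker b m =
     (if length m = length b
      then det (mat (length b) (length b) (\<lambda>(i, j). coef (b ! i) (m ! j))) else 0)"

text \<open>Closed sets are the zero loci of homogeneous polynomials in the Pluecker coordinates.\<close>

definition Gr_closed :: "nat \<Rightarrow> nat \<Rightarrow> ('i, 'k::field) dpoly set set \<Rightarrow> bool" where
  "Gr_closed k d Z \<longleftrightarrow>
     (\<exists>P :: ('i expo list, 'k) mpoly set.
        (\<forall>p\<in>P. \<exists>e. p \<in> homog_part e) \<and>
        Z = {V \<in> Gr k d. \<forall>b. basis_list V b \<longrightarrow> (\<forall>p\<in>P. mpoly_eval p (pluecker b) = 0)})"

definition Gr_closure ::
    "nat \<Rightarrow> nat \<Rightarrow> ('i, 'k::field) dpoly set set \<Rightarrow> ('i, 'k) dpoly set set" where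
  "Gr_closure k d A = \<Inter>{Z. Gr_closed k d Z \<and> A \<subseteq> Z}"

definition grassmann_cactus_variety ::
    "nat \<Rightarrow> nat \<Rightarrow> nat \<Rightarrow> ('i::finite, 'k::field) dpoly set set" where
  "grassmann_cactus_variety r k d = Gr_closure k d {V \<in> Gr k d. cactus_rank d V \<le> enat r}"

definition border_cactus_rank :: "nat \<Rightarrow> ('i::finite, 'k::field) dpoly set \<Rightarrow> enat" where
  "border_cactus_rank d V =
     Inf {enat r | r. 0 < r \<and> V \<in> grassmann_cactus_variety r (pm.dim V) d}"

end

theory Submission
  imports Defs
begin

text \<open>
  Homogenization is one linear map \<open>\<iota>\<^sub>e\<close> from \<open>S\<close> to \<open>T\<^sub>e\<close>, on polynomials as well as on divided powers,
  and \<open>W\<^bsup>hom,d\<^sub>2\<^esup> = \<iota>\<^sub>d(W)\<close> for \<open>d = d\<^sub>1 + d\<^sub>2\<close>.  Writing \<open>\<delta>\<close> for the substitution \<open>\<alpha>\<^sub>0 = 1\<close>, every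
  \<open>\<theta> \<in> T\<^sup>*\<^sub>e\<close> satisfies \<open>\<theta> \<lrcorner> \<iota>\<^sub>d(F) = \<iota>\<^bsub>d-e\<^esub>(\<delta>(\<theta>) \<lrcorner> F)\<close>.  Hence \<open>I = Ann(W)\<^bsup>hom\<^esup>\<close>, which in degree \<open>e\<close>
  consists of the \<open>\<theta>\<close> with \<open>\<delta>(\<theta>) \<in> Ann(W)\<close>, lies in \<open>Ann(W\<^bsup>hom,d\<^sub>2\<^esup>)\<close> and coincides with it in degrees
  \<open>\<le> d\<^sub>2\<close>.  It is saturated with Hilbert function \<open>r\<close> from degree \<open>d\<^sub>1\<close> on.  This gives (i) and, on
  comparing Hilbert functions in degree \<open>d\<^sub>1\<close>, the first half of (ii).  In (iii) the ideals \<open>J\<close> and \<open>I\<close>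
  agree in degree \<open>d\<^sub>1 + 1\<close> for dimension reasons, and this piece generates \<open>I\<close> in all higher degrees,
  because monomials of degree \<open>> d\<^sub>1\<close> without \<open>\<alpha>\<^sub>0\<close> belong to \<open>I\<close>.

  For the border cactus rank, subspaces \<open>V\<close> of cactus rank \<open>\<le> s\<close> have catalecticant rank
  \<open>dim T\<^sup>*\<^sub>e/Ann(V)\<^sub>e \<le> s\<close>, because the Hilbert function of a saturated ideal is nondecreasing.  This is
  a closed condition on the Grassmannian: by Cramer's rule the catalecticant minors are polynomials in
  the Pluecker coordinates.  It fails for \<open>W\<^bsup>hom,d\<^sub>2\<^esup>\<close> with \<open>e = d\<^sub>1\<close> and \<open>s < r\<close>.
\<close>

section \<open>Linear algebra modulo a subspace\<close>

text \<open>Gaussian elimination by induction on the equations: a pivot unknown of equation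
  \<open>y\<close> is eliminated, which leaves one equation and one unknown fewer. The dimension
  counts for quotients below rest on this lemma.\<close>

lemma homogeneous_system_nontrivial_solution:
  fixes M :: "'x \<Rightarrow> 'y \<Rightarrow> 'k::field"
  assumes "finite Y" "finite X" "card Y < card X"
  shows "\<exists>a. (\<exists>x\<in>X. a x \<noteq> 0) \<and> (\<forall>y\<in>Y. (\<Sum>x\<in>X. a x * M x y) = 0)"
  using assms
proof (induction Y arbitrary: X M rule: finite_induct)
  case empty
  then obtain x where "x \<in> X" by fastforce
  then show ?case by (intro exI[of _ "\<lambda>_. 1"]) auto
next
  case (insert y Y)
  show ?case
  proof (cases "\<exists>x0\<in>X. M x0 y \<noteq> 0")
    case False
    have "card Y < card X" using insert by simp
    from insert.IH[OF insert.prems(1) this, of M] False show ?thesis by fastforce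
  next
    case True
    then obtain x0 where x0: "x0 \<in> X" "M x0 y \<noteq> 0" by blast
    let ?X = "X - {x0}"
    let ?M = "\<lambda>x z. M x z - M x y / M x0 y * M x0 z"
    have "card Y < card ?X" using insert x0 by simp
    from insert.IH[OF _ this, of ?M] insert.prems(1) obtain a
      where a: "\<exists>x\<in>?X. a x \<noteq> 0" "\<forall>z\<in>Y. (\<Sum>x\<in>?X. a x * ?M x z) = 0" by auto
    \<comment> \<open>The value at the pivot \<open>x0\<close> is the one that solves equation
      \<open>y\<close>; with it every full sum equals the reduced one.\<close>
    define b where "b = a(x0 := - (\<Sum>x\<in>?X. a x * (M x y / M x0 y)))"
    have eq: "(\<Sum>x\<in>X. b x * M x z) = (\<Sum>x\<in>?X. a x * ?M x z)" for z
    proof -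
      have "(\<Sum>x\<in>X. b x * M x z) = b x0 * M x0 z + (\<Sum>x\<in>?X. b x * M x z)"
        using insert.prems(1) x0(1) by (simp add: sum.remove)
      also have "(\<Sum>x\<in>?X. b x * M x z) = (\<Sum>x\<in>?X. a x * M x z)"
        by (rule sum.cong) (auto simp: b_def)
      also have "b x0 * M x0 z + (\<Sum>x\<in>?X. a x * M x z) = (\<Sum>x\<in>?X. a x * ?M x z)"
        by (simp add: b_def sum_distrib_right right_diff_distrib sum_subtractf mult.assoc)
      finally show ?thesis .
    qed
    have "?M x y = 0" for x using x0 by simp
    then have "(\<Sum>x\<in>X. b x * M x z) = 0" if "z \<in> insert y Y" for z
      using that a(2) unfolding eq by auto
    moreover have "\<exists>x\<in>X. b x \<noteq> 0" using a(1) by (auto simp: b_def)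
    ultimately show ?thesis by blast
  qed
qed

text \<open>A basis \<open>D\<close> of \<open>B\<close> is extended to a basis \<open>E\<close> of
  \<open>A\<close>, and the added vectors \<open>E - D\<close> represent a basis of the
  quotient.\<close>

lemma quotient_basis_exists:
  assumes "pm.subspace A" "pm.subspace B" "B \<subseteq> A"
  shows "\<exists>C. quotient_basis A B C"
proof -
  obtain D where D: "D \<subseteq> B" "pm.independent D" "B \<subseteq> pm.span D"
    by (rule pm.basis_exists[of B])
  have "D \<subseteq> A" using D assms by blast
  then obtain E where E: "D \<subseteq> E" "E \<subseteq> A" "pm.independent E" "A \<subseteq> pm.span E"
    using pm.maximal_independent_subset_extend[OF _ D(2)] by metis
  let ?C = "E - D"
  have spD: "pm.span D = B" using D assms(2) by (metis pm.span_minimal subset_antisym)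
  \<comment> \<open>The coordinates of such a \<open>v\<close> over \<open>E\<close> are supported
    both in \<open>E - D\<close> and in \<open>D\<close>, hence vanish.\<close>
  have "v = 0" if v: "v \<in> pm.span ?C" "v \<in> pm.span D" for v
  proof -
    have vE: "v \<in> pm.span E" using v(1) pm.span_mono[of ?C E] by blast
    have 1: "pm.representation E v = pm.representation ?C v"
      by (rule pm.representation_extend[OF E(3) v(1)]) auto
    have 2: "pm.representation E v = pm.representation D v"
      by (rule pm.representation_extend[OF E(3) v(2) E(1)])
    have "pm.representation E v b = 0" for b
      using pm.representation_ne_zero[of ?C v b] pm.representation_ne_zero[of D v b] 1 2
      by (metis DiffD2)
    then show "v = 0" using pm.sum_nonzero_representation_eq[OF E(3) vE] by simp
  qed
  then have "pm.span ?C \<inter> B = {0}" using spD pm.span_zero by blast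
  moreover have "\<exists>c\<in>pm.span ?C. a - c \<in> B" if "a \<in> A" for a
  proof -
    have "a \<in> pm.span (?C \<union> D)" using that E(1,4) by (metis Un_Diff_cancel2 Un_absorb2 subsetD)
    then obtain x y where "a = x + y" "x \<in> pm.span ?C" "y \<in> B" unfolding pm.span_Un spD by blast
    then show ?thesis by (intro bexI[of _ x]) auto
  qed
  ultimately show ?thesis
    unfolding quotient_basis_def using E pm.independent_mono[OF E(3), of ?C] by (intro exI[of _ ?C]) auto
qed

lemma quotient_basis_coordinates:
  assumes "quotient_basis A B C" "finite C" "a \<in> A"
  obtains q where "a - (\<Sum>c\<in>C. pscale (q c) c) \<in> B"
proof -
  obtain c where "c \<in> pm.span C" "a - c \<in> B" using assms unfolding quotient_basis_def by blast
  then show ?thesis using that pm.span_finite[OF assms(2)] by auto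
qed

text \<open>A relation between the coordinate vectors \<open>q x\<close> cancels everything but the
  congruence errors, which lie in \<open>B\<close>.\<close>

lemma sum_mem_mod_quotient_basis:
  assumes q: "\<And>x. x \<in> X \<Longrightarrow> f x - (\<Sum>c\<in>C. pscale (q x c) c) \<in> B"
    and a: "\<And>c. c \<in> C \<Longrightarrow> (\<Sum>x\<in>X. a x * q x c) = 0" and B: "pm.subspace B"
  shows "(\<Sum>x\<in>X. pscale (a x) (f x)) \<in> B"
proof -
  have "(\<Sum>x\<in>X. pscale (a x) (f x - (\<Sum>c\<in>C. pscale (q x c) c))) \<in> B"
    by (intro pm.subspace_sum B pm.subspace_scale q)
  also have "(\<Sum>x\<in>X. pscale (a x) (f x - (\<Sum>c\<in>C. pscale (q x c) c)))
      = (\<Sum>x\<in>X. pscale (a x) (f x)) - (\<Sum>x\<in>X. \<Sum>c\<in>C. pscale (a x * q x c) c)"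
    by (simp add: pm.scale_right_diff_distrib sum_subtractf pm.scale_sum_right)
  also have "(\<Sum>x\<in>X. \<Sum>c\<in>C. pscale (a x * q x c) c) = (\<Sum>c\<in>C. pscale (\<Sum>x\<in>X. a x * q x c) c)"
    by (subst sum.swap) (simp add: pm.scale_sum_left)
  also have "\<dots> = 0" by (simp add: a)
  finally show ?thesis by simp
qed

lemma many_vectors_dependent_mod:
  assumes C: "quotient_basis A B C" "finite C" and B: "pm.subspace B"
    and X: "finite X" "card C < card X" "\<And>x. x \<in> X \<Longrightarrow> f x \<in> A"
  obtains a where "\<exists>x\<in>X. a x \<noteq> 0" "(\<Sum>x\<in>X. pscale (a x) (f x)) \<in> B"
proof -
  have "\<forall>x\<in>X. \<exists>q. f x - (\<Sum>c\<in>C. pscale (q c) c) \<in> B"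
    using quotient_basis_coordinates[OF C] X(3) by metis
  then obtain q where q: "\<And>x. x \<in> X \<Longrightarrow> f x - (\<Sum>c\<in>C. pscale (q x c) c) \<in> B" by metis
  obtain a where a: "\<exists>x\<in>X. a x \<noteq> 0" "\<forall>y\<in>C. (\<Sum>x\<in>X. a x * q x y) = 0"
    using homogeneous_system_nontrivial_solution[OF C(2) X(1,2), of q] by blast
  have "(\<Sum>x\<in>X. pscale (a x) (f x)) \<in> B"
    by (rule sum_mem_mod_quotient_basis[OF q _ B]) (use a in auto)
  with a show ?thesis using that by blast
qed

abbreviation plinear :: "(('a \<Rightarrow>\<^sub>0 'k::field) \<Rightarrow> ('b \<Rightarrow>\<^sub>0 'k)) \<Rightarrow> bool" where
  "plinear \<equiv> Vector_Spaces.linear pscale pscale"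

text \<open>More than \<open>card C\<close> vectors have images that are dependent modulo
  \<open>B\<close>; by \<open>inj\<close> the corresponding combination in \<open>pm.span X\<close>
  is zero, against independence.\<close>

lemma independent_mod_card_le:
  assumes C: "quotient_basis A B C" "finite C" and B: "pm.subspace B"
    and X: "pm.independent X" and f: "plinear f" "f ` X \<subseteq> A"
    and inj: "\<And>x. x \<in> pm.span X \<Longrightarrow> f x \<in> B \<Longrightarrow> x = 0"
  shows "finite X" "card X \<le> card C"
proof -
  interpret f: Vector_Spaces.linear pscale pscale f by fact
  have *: "card Y \<le> card C" if Y: "Y \<subseteq> X" "finite Y" for Y
  proof (rule ccontr)
    assume "\<not> card Y \<le> card C"
    then have "card C < card Y" by simp
    moreover have "f x \<in> A" if "x \<in> Y" for x using f(2) Y(1) that by blast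
    ultimately obtain a where a: "\<exists>x\<in>Y. a x \<noteq> 0" "(\<Sum>x\<in>Y. pscale (a x) (f x)) \<in> B"
      by (rule many_vectors_dependent_mod[OF C B Y(2)])
    have "f (\<Sum>x\<in>Y. pscale (a x) x) \<in> B" using a(2) by (simp add: f.sum f.scale)
    moreover have "(\<Sum>x\<in>Y. pscale (a x) x) \<in> pm.span X"
      using Y(1) by (intro pm.span_sum pm.span_scale pm.span_base) auto
    ultimately have "(\<Sum>x\<in>Y. pscale (a x) x) = 0" using inj by blast
    moreover have "pm.independent Y" using pm.independent_mono[OF X Y(1)] .
    ultimately show False using a(1) pm.dependent_finite[OF Y(2)] by blast
  qed
  show fin: "finite X"
  proof (rule ccontr)
    assume "infinite X"
    then obtain Y where "Y \<subseteq> X" "finite Y" "card Y = Suc (card C)"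
      using infinite_arbitrarily_large by blast
    with *[of Y] show False by simp
  qed
  show "card X \<le> card C" using * fin by blast
qed

lemma plinear_id: "plinear (\<lambda>x. x)"
  using pm.linear_id by (simp add: id_def)

section \<open>Dimensions of quotient spaces\<close>

text \<open>Finiteness is carried along because \<open>quotient_dim\<close> takes the default value
  \<open>0\<close> on infinite-dimensional quotients.\<close>

definition fin_quotient :: "('a \<Rightarrow>\<^sub>0 'k::field) set \<Rightarrow> ('a \<Rightarrow>\<^sub>0 'k) set \<Rightarrow> bool" where
  "fin_quotient A B \<longleftrightarrow> pm.subspace A \<and> pm.subspace B \<and> B \<subseteq> A \<and> (\<exists>C. quotient_basis A B C \<and> finite C)"

text \<open>Applying \<open>independent_mod_card_le\<close> with the identity in both directions
  shows that any two quotient bases have the same size, so the choice made by \<open>SOME\<close> is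
  immaterial.\<close>

lemma quotient_dim_eq_card:
  assumes "fin_quotient A B" "quotient_basis A B C"
  shows "finite C" "quotient_dim A B = card C"
proof -
  obtain C0 where C0: "quotient_basis A B C0" "finite C0" and B: "pm.subspace B"
    using assms(1) unfolding fin_quotient_def by blast
  have *: "finite D \<and> card D \<le> card C'" if D: "quotient_basis A B D"
    and C': "quotient_basis A B C'" "finite C'" for D C'
    using independent_mod_card_le[OF C' B _ plinear_id, of D] D
    unfolding quotient_basis_def by blast
  have S: "quotient_basis A B (SOME C. quotient_basis A B C)" by (rule someI) (rule C0(1))
  show "finite C" using * assms(2) C0 by blast
  show "quotient_dim A B = card C" unfolding quotient_dim_def
    using *[OF S] *[OF _ S] * assms(2) C0 by (meson le_antisym)
qed

lemma fin_quotient_basis: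
  assumes "fin_quotient A B"
  obtains C where "quotient_basis A B C" "finite C" "quotient_dim A B = card C"
  using assms quotient_dim_eq_card[OF assms] unfolding fin_quotient_def by blast

text \<open>The map \<open>f\<close> is injective modulo \<open>B'\<close> on the complement
  \<open>pm.span C\<close> of \<open>B\<close> in \<open>A\<close>.\<close>

lemma quotient_dim_le:
  assumes fq: "fin_quotient A' B'" and A: "pm.subspace A" "pm.subspace B" "B \<subseteq> A"
    and f: "plinear f" "f ` A \<subseteq> A'" and inj: "\<And>x. x \<in> A \<Longrightarrow> f x \<in> B' \<Longrightarrow> x \<in> B"
  shows "fin_quotient A B" "quotient_dim A B \<le> quotient_dim A' B'"
proof -
  obtain C' where C': "quotient_basis A' B' C'" "finite C'" "quotient_dim A' B' = card C'"
    using fin_quotient_basis[OF fq] .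
  obtain C where C: "quotient_basis A B C" using quotient_basis_exists[OF A] by blast
  then have sp: "pm.span C \<subseteq> A" by (simp add: A(1) pm.span_minimal quotient_basis_def)
  have "finite C \<and> card C \<le> card C'"
    using independent_mod_card_le[OF C'(1,2) _ _ f(1), of C] fq C f(2) inj sp
    unfolding quotient_basis_def fin_quotient_def by blast
  then show "fin_quotient A B" "quotient_dim A B \<le> quotient_dim A' B'"
    using C A C'(3) quotient_dim_eq_card unfolding fin_quotient_def by metis+
qed

text \<open>A quotient basis modulo \<open>B2\<close> stays independent modulo \<open>B1\<close>; if
  \<open>B2\<close> is strictly larger, a vector of \<open>B2\<close> outside \<open>B1\<close> can
  be added to it.\<close>

lemma quotient_dim_antimono:
  assumes fq: "fin_quotient A B1" and B: "pm.subspace B2" "B1 \<subseteq> B2" "B2 \<subseteq> A"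
  shows "fin_quotient A B2" "quotient_dim A B2 \<le> quotient_dim A B1"
    and "quotient_dim A B2 = quotient_dim A B1 \<Longrightarrow> B2 = B1"
proof -
  have A: "pm.subspace A" "pm.subspace B1" using fq unfolding fin_quotient_def by auto
  obtain C1 where C1: "quotient_basis A B1 C1" "finite C1" "quotient_dim A B1 = card C1"
    using fin_quotient_basis[OF fq] .
  obtain C where C: "quotient_basis A B2 C" using quotient_basis_exists[OF A(1) B(1,3)] by blast
  have *: "finite C \<and> card C \<le> card C1"
    using independent_mod_card_le[OF C1(1,2) A(2) _ plinear_id, of C] C B(2)
    unfolding quotient_basis_def by blast
  then show fq2: "fin_quotient A B2" using A B C unfolding fin_quotient_def by blast
  have qd: "quotient_dim A B2 = card C" using quotient_dim_eq_card[OF fq2 C] by simp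
  then show "quotient_dim A B2 \<le> quotient_dim A B1" using * C1(3) by simp
  show "B2 = B1" if eq: "quotient_dim A B2 = quotient_dim A B1"
  proof (rule ccontr)
    assume "B2 \<noteq> B1"
    then obtain b where b: "b \<in> B2" "b \<notin> B1" using B by blast
    have b0: "b \<noteq> 0" using b A(2) pm.subspace_0 by blast
    have sC: "pm.span C \<inter> B2 = {0}" using C unfolding quotient_basis_def by blast
    have bC: "b \<notin> pm.span C" using sC b b0 by blast
    have ind: "pm.independent (insert b C)"
      using C bC by (simp add: pm.independent_insert quotient_basis_def)
    have "x = 0" if x: "x \<in> pm.span (insert b C)" "x \<in> B1" for x
    proof -
      obtain k where k: "x - pscale k b \<in> pm.span C" using x(1) pm.span_breakdown_eq by blast
      have "x - pscale k b \<in> B2" using x(2) B b by (simp add: pm.subspace_diff pm.subspace_scale subsetD)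
      then have "x - pscale k b = 0" using k sC by blast
      then have xk: "x = pscale k b" by simp
      show "x = 0"
      proof (cases "k = 0")
        case False
        have "pscale (inverse k) x \<in> B1" using x(2) A(2) pm.subspace_scale by blast
        then show ?thesis using xk False b(2) by simp
      qed (simp add: xk)
    qed
    then have "card (insert b C) \<le> card C1"
      using independent_mod_card_le(2)[OF C1(1,2) A(2) ind plinear_id] C b(1) B(3)
      unfolding quotient_basis_def by auto
    moreover have "b \<notin> C" using bC pm.span_base by blast
    ultimately show False using * eq qd C1(3) by simp
  qed
qed

text \<open>The functional is prescribed as \<open>0\<close> on a basis of \<open>E\<close> and as
  \<open>1\<close> at \<open>F\<close>. It translates between subspaces and the linear forms
  vanishing on them.\<close>

lemma separating_functional:
  assumes "pm.subspace E" "F \<notin> E"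
  obtains \<phi> :: "('a \<Rightarrow>\<^sub>0 'k::field) \<Rightarrow> 'k"
  where "Vector_Spaces.linear pscale (*) \<phi>" "\<And>G. G \<in> E \<Longrightarrow> \<phi> G = 0" "\<phi> F = 1"
proof -
  interpret vector_space_pair "pscale :: 'k \<Rightarrow> ('a \<Rightarrow>\<^sub>0 'k) \<Rightarrow> _" "(*) :: 'k \<Rightarrow> 'k \<Rightarrow> 'k"
    by unfold_locales (auto simp: algebra_simps)
  obtain D where D: "D \<subseteq> E" "pm.independent D" "E \<subseteq> pm.span D"
    by (rule pm.basis_exists[of E])
  have spD: "pm.span D = E" using D assms(1) by (metis pm.span_minimal subset_antisym)
  have "pm.independent (insert F D)" using D assms(2) spD by (simp add: pm.independent_insert)
  from linear_independent_extend[OF this, of "\<lambda>x. if x = F then 1 else 0"] obtain \<phi>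
    where \<phi>: "Vector_Spaces.linear pscale (*) \<phi>" "\<forall>x\<in>insert F D. \<phi> x = (if x = F then 1 else 0)"
    by blast
  interpret \<phi>: Vector_Spaces.linear pscale "(*)" \<phi> by fact
  have "\<phi> G = 0" if "G \<in> E" for G
  proof (rule \<phi>.eq_0_on_span)
    show "G \<in> pm.span D" using that spD by simp
    show "\<phi> x = 0" if "x \<in> D" for x using that \<phi>(2) D(1) assms(2) by auto
  qed
  then show ?thesis using that \<phi> by simp
qed

section \<open>Polynomials, ideals and contraction\<close>

lemma poly_mapping_sum_singles: "f = (\<Sum>u\<in>Poly_Mapping.keys f. Poly_Mapping.single u (coef f u))"
proof (rule poly_mapping_eqI)
  fix w
  have "coef (\<Sum>u\<in>Poly_Mapping.keys f. Poly_Mapping.single u (coef f u)) w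
      = (\<Sum>u\<in>Poly_Mapping.keys f. if u = w then coef f w else 0)"
    unfolding lookup_sum by (rule sum.cong) (auto simp: lookup_single when_def)
  then show "coef f w = coef (\<Sum>u\<in>Poly_Mapping.keys f. Poly_Mapping.single u (coef f u)) w"
    by (simp add: in_keys_iff)
qed

text \<open>Every element is a finite sum of terms, and \<open>0\<close> is a term with coefficient
  \<open>0\<close>, so additive identities need checking on terms only.\<close>

lemma poly_mapping_add_induct [case_names single add]:
  fixes f :: "'a \<Rightarrow>\<^sub>0 'b::comm_monoid_add"
  assumes "\<And>u c. P (Poly_Mapping.single u c)" "\<And>f g. P f \<Longrightarrow> P g \<Longrightarrow> P (f + g)"
  shows "P f"
proof -
  have P0: "P 0" using assms(1)[of _ 0] by simp
  have "P (\<Sum>u\<in>A. Poly_Mapping.single u (coef f u))" for A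
    by (induction A rule: infinite_finite_induct) (auto simp: P0 assms)
  then show ?thesis by (subst poly_mapping_sum_singles)
qed

lemma coef_single_mult:
  fixes u :: "'i expo" and g :: "('i, 'k::comm_ring_1) mpoly"
  shows "coef (Poly_Mapping.single u c * g) (u + w) = c * coef g w"
    and "(\<nexists>w. v = u + w) \<Longrightarrow> coef (Poly_Mapping.single u c * g) v = 0"
proof -
  show "coef (Poly_Mapping.single u c * g) (u + w) = c * coef g w"
    by (induction g rule: poly_mapping_add_induct)
      (auto simp: mult_single lookup_single when_def distrib_left lookup_add)
  show "coef (Poly_Mapping.single u c * g) v = 0" if "\<nexists>w. v = u + w"
    using that by (induction g rule: poly_mapping_add_induct)
      (auto simp: mult_single lookup_single when_def distrib_left lookup_add)
qed

lemma pscale_eq_mult: "pscale c f = Poly_Mapping.single 0 c * (f :: ('i, 'k::field) mpoly)"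
  by (rule poly_mapping_eqI) (use coef_single_mult(1)[of 0 c f] in \<open>simp add: lookup_pscale\<close>)

section \<open>Degrees and homogeneous components\<close>

lemma mdeg_superset:
  assumes "finite A" "Poly_Mapping.keys u \<subseteq> A"
  shows "mdeg u = (\<Sum>i\<in>A. coef u i)"
  unfolding mdeg_def
  by (rule sum.mono_neutral_left) (use assms in \<open>auto simp: in_keys_iff\<close>)

lemma mdeg_zero [simp]: "mdeg 0 = 0"
  by (simp add: mdeg_def)

lemma mdeg_add [simp]: "mdeg (u + v) = mdeg u + mdeg v"
proof -
  let ?A = "Poly_Mapping.keys u \<union> Poly_Mapping.keys v"
  have "Poly_Mapping.keys (u + v) \<subseteq> ?A" by (rule Poly_Mapping.keys_add)
  then show ?thesis
    by (simp add: mdeg_superset[of ?A] lookup_add sum.distrib)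
qed

lemma mdeg_single [simp]: "mdeg (Poly_Mapping.single i j) = j"
  by (simp add: mdeg_def)

lemma homog_part_iff: "f \<in> homog_part e \<longleftrightarrow> (\<forall>u. coef f u \<noteq> 0 \<longrightarrow> mdeg u = e)"
  by (auto simp: homog_part_def in_keys_iff)

lemma deg_le_part_iff: "f \<in> deg_le_part e \<longleftrightarrow> (\<forall>u. coef f u \<noteq> 0 \<longrightarrow> mdeg u \<le> e)"
  by (auto simp: deg_le_part_def in_keys_iff)

lemma coef_hcomp: "coef (hcomp e f) u = (if mdeg u = e then coef f u else 0)"
proof -
  have "coef (hcomp e f) u = (\<Sum>v\<in>{v\<in>Poly_Mapping.keys f. mdeg v = e}. if v = u then coef f u else 0)"
    unfolding hcomp_def lookup_sum by (rule sum.cong) (auto simp: lookup_single when_def)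
  then show ?thesis by (auto simp: in_keys_iff)
qed

lemma hcomp_in_homog_part: "hcomp e f \<in> homog_part e"
  by (simp add: homog_part_iff coef_hcomp)

lemma hcomp_zero [simp]: "hcomp e 0 = 0"
  by (rule poly_mapping_eqI) (simp add: coef_hcomp)

lemma hcomp_add: "hcomp e (f + g) = hcomp e f + hcomp e g"
  by (rule poly_mapping_eqI) (simp add: coef_hcomp lookup_add)

lemma hcomp_homog: "f \<in> homog_part e \<Longrightarrow> hcomp e' f = (if e' = e then f else 0)"
  by (rule poly_mapping_eqI) (auto simp: coef_hcomp homog_part_iff)

lemma sum_hcomp: "f = (\<Sum>e\<in>mdeg ` Poly_Mapping.keys f. hcomp e f)"
proof (rule poly_mapping_eqI)
  fix u
  have "coef (\<Sum>e\<in>mdeg ` Poly_Mapping.keys f. hcomp e f) u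
      = (\<Sum>e\<in>mdeg ` Poly_Mapping.keys f. if e = mdeg u then coef f u else 0)"
    unfolding lookup_sum by (rule sum.cong) (auto simp: coef_hcomp)
  then show "coef f u = coef (\<Sum>e\<in>mdeg ` Poly_Mapping.keys f. hcomp e f) u"
    by (auto simp: in_keys_iff)
qed

lemma hcomp_single_mult:
  fixes f :: "('i, 'k::comm_ring_1) mpoly"
  shows "hcomp e (Poly_Mapping.single u c * f) =
    (if mdeg u \<le> e then Poly_Mapping.single u c * hcomp (e - mdeg u) f else 0)"
proof (rule poly_mapping_eqI)
  fix v
  show "coef (hcomp e (Poly_Mapping.single u c * f)) v =
    coef (if mdeg u \<le> e then Poly_Mapping.single u c * hcomp (e - mdeg u) f else 0) v"
  proof (cases "\<exists>w. v = u + w")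
    case True
    then obtain w where "v = u + w" by blast
    then show ?thesis by (auto simp: coef_hcomp coef_single_mult(1))
  next
    case False
    then show ?thesis by (auto simp: coef_hcomp coef_single_mult(2))
  qed
qed

lemma subspace_homog_part: "pm.subspace (homog_part e :: ('i expo \<Rightarrow>\<^sub>0 'k::field) set)"
  unfolding pm.subspace_def
  by (auto simp: homog_part_iff lookup_add lookup_pscale)
    (metis add.right_neutral add_cancel_left_left)

lemma homog_part_single_mult:
  fixes f :: "('i, 'k::comm_ring_1) mpoly"
  assumes "f \<in> homog_part e"
  shows "Poly_Mapping.single u c * f \<in> homog_part (mdeg u + e)"
  unfolding homog_part_iff
proof (intro allI impI)
  fix v
  assume nz: "coef (Poly_Mapping.single u c * f) v \<noteq> 0"
  then have "\<exists>w. v = u + w" using coef_single_mult(2)[of v u c f] by blast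
  then obtain w where w: "v = u + w" by blast
  then have "coef f w \<noteq> 0" using nz coef_single_mult(1)[of u c f w] by auto
  then have "mdeg w = e" using assms by (simp add: homog_part_iff)
  then show "mdeg v = mdeg u + e" using w by simp
qed

lemma homog_part_mult:
  fixes f g :: "('i, 'k::field) mpoly"
  assumes "f \<in> homog_part d" "g \<in> homog_part e"
  shows "f * g \<in> homog_part (d + e)"
proof -
  have "(\<Sum>u\<in>Poly_Mapping.keys f. Poly_Mapping.single u (coef f u) * g) \<in> homog_part (d + e)"
  proof (rule pm.subspace_sum[OF subspace_homog_part])
    fix u assume "u \<in> Poly_Mapping.keys f"
    then have "mdeg u = d" using assms(1) by (simp add: homog_part_def)
    then show "Poly_Mapping.single u (coef f u) * g \<in> homog_part (d + e)"
      using homog_part_single_mult[OF assms(2)] by metis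
  qed
  moreover have "f * g = (\<Sum>u\<in>Poly_Mapping.keys f. Poly_Mapping.single u (coef f u)) * g"
    by (rule arg_cong[OF poly_mapping_sum_singles])
  ultimately show ?thesis by (simp add: sum_distrib_right)
qed

text \<open>Every entry of an exponent is at most its degree.\<close>

lemma finite_mdeg_eq: "finite {u :: 'i::finite expo. mdeg u = e}"
proof (rule inj_on_finite[of Poly_Mapping.lookup])
  show "inj_on Poly_Mapping.lookup {u :: 'i expo. mdeg u = e}"
    by (rule inj_onI) (simp add: lookup_inject)
  show "Poly_Mapping.lookup ` {u :: 'i expo. mdeg u = e} \<subseteq> PiE UNIV (\<lambda>_. {..e})"
  proof (clarsimp simp: PiE_iff)
    fix u :: "'i expo" and i
    show "coef u i \<le> mdeg u" using member_le_sum[of i UNIV "coef u"] mdeg_superset[of UNIV u] by simp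
  qed
  show "finite (PiE (UNIV :: 'i set) (\<lambda>_. {..e}))" by (rule finite_PiE) auto
qed

text \<open>With more vectors than monomials of degree \<open>e\<close>, comparing coefficients is a
  linear system with more unknowns than equations.\<close>

lemma finite_independent_homog_part:
  fixes X :: "('i::finite, 'k::field) mpoly set"
  assumes X: "pm.independent X" "X \<subseteq> homog_part e"
  shows "finite X"
proof (rule ccontr)
  assume "infinite X"
  then obtain Y where Y: "Y \<subseteq> X" "finite Y" "card Y = Suc (card {u :: 'i expo. mdeg u = e})"
    using infinite_arbitrarily_large by blast
  then obtain a where a: "\<exists>x\<in>Y. a x \<noteq> 0"
    "\<And>u. mdeg u = e \<Longrightarrow> (\<Sum>x\<in>Y. a x * coef x u) = 0"
    using homogeneous_system_nontrivial_solution[OF finite_mdeg_eq[of e] Y(2), of "\<lambda>x u. coef x u"]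
    by auto
  have "(\<Sum>x\<in>Y. pscale (a x) x) = 0"
  proof (rule poly_mapping_eqI)
    fix u
    have "coef x u = 0" if "x \<in> Y" "mdeg u \<noteq> e" for x
      using that X(2) Y(1) homog_part_iff by blast
    then show "coef (\<Sum>x\<in>Y. pscale (a x) x) u = coef 0 u"
      using a(2)[of u] by (cases "mdeg u = e") (auto simp: lookup_sum lookup_pscale)
  qed
  moreover have "pm.independent Y" using pm.independent_mono[OF X(1) Y(1)] .
  ultimately show False using a(1) pm.dependent_finite[OF Y(2)] by blast
qed

lemma fin_quotient_homog_part:
  fixes B :: "('i::finite, 'k::field) mpoly set"
  assumes "pm.subspace B"
  shows "fin_quotient (homog_part e) (B \<inter> homog_part e)"
proof -
  have B: "pm.subspace (B \<inter> homog_part e)"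
    using assms subspace_homog_part by (rule pm.subspace_inter)
  obtain C where "quotient_basis (homog_part e) (B \<inter> homog_part e) C"
    using quotient_basis_exists[OF subspace_homog_part B] by blast
  moreover from this have "finite C"
    unfolding quotient_basis_def by (blast intro: finite_independent_homog_part)
  ultimately show ?thesis
    unfolding fin_quotient_def using B subspace_homog_part by blast
qed

section \<open>Ideals of polynomial rings\<close>

lemma module_times: "Modules.module ((*) :: 'a::comm_ring_1 \<Rightarrow> 'a \<Rightarrow> 'a)"
  by unfold_locales (auto simp: algebra_simps)

lemma is_ideal_iff:
  "is_ideal I \<longleftrightarrow> 0 \<in> I \<and> (\<forall>x\<in>I. \<forall>y\<in>I. x + y \<in> I) \<and> (\<forall>c. \<forall>x\<in>I. c * x \<in> I)"
  unfolding is_ideal_def module.subspace_def[OF module_times] by blast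

lemma ideal_sum: "is_ideal I \<Longrightarrow> (\<And>x. x \<in> X \<Longrightarrow> f x \<in> I) \<Longrightarrow> sum f X \<in> I"
  unfolding is_ideal_def by (rule module.subspace_sum[OF module_times])

lemma ideal_gen_superset: "X \<subseteq> ideal_gen X"
  unfolding ideal_gen_def by (rule module.span_superset[OF module_times])

lemma is_ideal_ideal_gen: "is_ideal (ideal_gen X)"
  unfolding ideal_gen_def is_ideal_def by (rule module.subspace_span[OF module_times])

lemma ideal_gen_minimal: "X \<subseteq> I \<Longrightarrow> is_ideal I \<Longrightarrow> ideal_gen X \<subseteq> I"
  unfolding ideal_gen_def is_ideal_def by (rule module.span_minimal[OF module_times])

lemma is_idealI:
  fixes I :: "('i, 'k::comm_ring_1) mpoly set"
  assumes "0 \<in> I" "\<And>f g. f \<in> I \<Longrightarrow> g \<in> I \<Longrightarrow> f + g \<in> I"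
    "\<And>u c f. f \<in> I \<Longrightarrow> Poly_Mapping.single u c * f \<in> I"
  shows "is_ideal I"
proof -
  have "g * f \<in> I" if "f \<in> I" for f g
    by (induction g rule: poly_mapping_add_induct) (auto simp: assms that distrib_right)
  then show ?thesis using assms unfolding is_ideal_iff by blast
qed

lemma ideal_subspace: "is_ideal (I :: ('i, 'k::field) mpoly set) \<Longrightarrow> pm.subspace I"
  unfolding is_ideal_iff pm.subspace_def pscale_eq_mult by blast

lemma ideal_diff: "is_ideal I \<Longrightarrow> x \<in> I \<Longrightarrow> y \<in> I \<Longrightarrow> x - y \<in> I"
  unfolding is_ideal_def by (rule module.subspace_diff[OF module_times])

lemma ideal_mem_if_hcomp_mem: "is_ideal I \<Longrightarrow> (\<And>e. hcomp e f \<in> I) \<Longrightarrow> f \<in> I"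
  using ideal_sum[of I "mdeg ` Poly_Mapping.keys f" "\<lambda>e. hcomp e f"] sum_hcomp[of f] by metis

section \<open>The contraction action\<close>

text \<open>The case distinction and the truncated subtraction \<open>v - u\<close> in the
  definition amount to \<open>v = u + w\<close>, so the sum over \<open>v\<close> collapses to one
  term.\<close>

lemma coef_contract: "coef (\<theta> \<lrcorner> F) w = (\<Sum>u\<in>Poly_Mapping.keys \<theta>. coef \<theta> u * coef F (u + w))"
proof -
  have "coef (\<Sum>v\<in>Poly_Mapping.keys F. if \<forall>i. coef u i \<le> coef v i
        then Poly_Mapping.single (v - u) (coef \<theta> u * coef F v) else 0) w = coef \<theta> u * coef F (u + w)" for u
  proof -
    have *: "(\<forall>i. coef u i \<le> coef v i) \<and> v - u = w \<longleftrightarrow> v = u + w" for v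
    proof
      assume a: "(\<forall>i. coef u i \<le> coef v i) \<and> v - u = w"
      show "v = u + w"
        by (rule poly_mapping_eqI) (use a in \<open>auto simp: lookup_add lookup_minus\<close>)
    qed (auto simp: lookup_add)
    have "coef (\<Sum>v\<in>Poly_Mapping.keys F. if \<forall>i. coef u i \<le> coef v i
        then Poly_Mapping.single (v - u) (coef \<theta> u * coef F v) else 0) w
      = (\<Sum>v\<in>Poly_Mapping.keys F. if v = u + w then coef \<theta> u * coef F (u + w) else 0)"
      unfolding lookup_sum
    proof (rule sum.cong[OF refl])
      fix v
      show "coef (if \<forall>i. coef u i \<le> coef v i
        then Poly_Mapping.single (v - u) (coef \<theta> u * coef F v) else 0) w
         = (if v = u + w then coef \<theta> u * coef F (u + w) else 0)"
        using *[of v] by (auto simp: lookup_single when_def)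
    qed
    also have "\<dots> = coef \<theta> u * coef F (u + w)" by (auto simp: in_keys_iff)
    finally show ?thesis .
  qed
  then show ?thesis unfolding contract_def lookup_sum[of _ "Poly_Mapping.keys \<theta>"] by simp
qed

lemma coef_contract_superset:
  assumes "finite A" "Poly_Mapping.keys \<theta> \<subseteq> A"
  shows "coef (\<theta> \<lrcorner> F) w = (\<Sum>u\<in>A. coef \<theta> u * coef F (u + w))"
  unfolding coef_contract
  by (rule sum.mono_neutral_left) (use assms in \<open>auto simp: in_keys_iff\<close>)

lemma contract_add_left: "(\<theta> + \<eta>) \<lrcorner> F = \<theta> \<lrcorner> F + \<eta> \<lrcorner> F"
proof (rule poly_mapping_eqI)
  fix w
  let ?A = "Poly_Mapping.keys \<theta> \<union> Poly_Mapping.keys \<eta>"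
  have "Poly_Mapping.keys (\<theta> + \<eta>) \<subseteq> ?A" by (rule Poly_Mapping.keys_add)
  then show "coef ((\<theta> + \<eta>) \<lrcorner> F) w = coef (\<theta> \<lrcorner> F + \<eta> \<lrcorner> F) w"
    by (simp add: coef_contract_superset[of ?A] lookup_add distrib_right sum.distrib)
qed

lemma contract_add_right: "\<theta> \<lrcorner> (F + G) = \<theta> \<lrcorner> F + \<theta> \<lrcorner> G"
  by (rule poly_mapping_eqI) (simp add: coef_contract lookup_add distrib_left sum.distrib)

lemma contract_zero_left [simp]: "0 \<lrcorner> F = 0"
  by (rule poly_mapping_eqI) (simp add: coef_contract)

lemma contract_zero_right [simp]: "\<theta> \<lrcorner> 0 = 0"
  by (rule poly_mapping_eqI) (simp add: coef_contract)

lemma contract_sum_left: "(\<Sum>x\<in>X. f x) \<lrcorner> F = (\<Sum>x\<in>X. f x \<lrcorner> F)"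
  by (induction X rule: infinite_finite_induct) (auto simp: contract_add_left)

lemma contract_sum_right: "\<theta> \<lrcorner> (\<Sum>x\<in>X. f x) = (\<Sum>x\<in>X. \<theta> \<lrcorner> f x)"
  by (induction X rule: infinite_finite_induct) (auto simp: contract_add_right)

lemma contract_pscale_right: "\<theta> \<lrcorner> pscale c F = pscale c (\<theta> \<lrcorner> F)"
  by (rule poly_mapping_eqI) (simp add: coef_contract lookup_pscale sum_distrib_left mult_ac)

lemma coef_contract_single: "coef (Poly_Mapping.single u c \<lrcorner> F) w = c * coef F (u + w)"
  by (simp add: coef_contract_superset[of "{u}"])

lemma contract_mult: "(\<theta> * \<eta>) \<lrcorner> F = \<theta> \<lrcorner> (\<eta> \<lrcorner> F)"
proof (induction \<theta> rule: poly_mapping_add_induct)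
  case (single u c)
  show ?case
  proof (induction \<eta> rule: poly_mapping_add_induct)
    case (single v d)
    show ?case
      by (rule poly_mapping_eqI) (simp add: coef_contract_single mult_single ac_simps)
  qed (simp add: distrib_left contract_add_left contract_add_right)
qed (simp add: distrib_right contract_add_left)

lemma is_ideal_Ann: "is_ideal (Ann V)"
  unfolding is_ideal_iff Ann_def by (auto simp: contract_add_left contract_mult)

lemma coef_contract_homog:
  assumes "\<theta> \<in> homog_part e" "F \<in> homog_part d" "coef (\<theta> \<lrcorner> F) w \<noteq> 0"
  shows "e + mdeg w = d"
proof -
  obtain u where "coef \<theta> u * coef F (u + w) \<noteq> 0"
    using assms(3) unfolding coef_contract by (meson sum.neutral)
  then have "coef \<theta> u \<noteq> 0" "coef F (u + w) \<noteq> 0" by auto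
  then show ?thesis using assms(1,2) by (metis homog_part_iff mdeg_add)
qed

section \<open>Homogenization\<close>

text \<open>On monomials this is the substitution of \<open>1\<close> for the variable of index
  \<open>None\<close>.\<close>

definition restr :: "'n::finite option expo \<Rightarrow> 'n expo" where
  "restr w = (\<Sum>i\<in>UNIV. Poly_Mapping.single i (coef w (Some i)))"

lemma coef_restr [simp]: "coef (restr w) i = coef w (Some i)"
proof -
  have "coef (restr w) i = (\<Sum>j\<in>UNIV. if j = i then coef w (Some i) else 0)"
    unfolding restr_def lookup_sum by (rule sum.cong) (auto simp: lookup_single when_def)
  then show ?thesis by simp
qed

lemma restr_add: "restr (u + v) = restr u + restr v"
  by (rule poly_mapping_eqI) (simp add: lookup_add)

lemma coef_expo_embed [simp]:
  "coef (expo_embed u) (Some i) = coef u i" "coef (expo_embed u) None = 0"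
proof -
  have "coef (expo_embed u) (Some i) = (\<Sum>j\<in>Poly_Mapping.keys u. if j = i then coef u i else 0)"
    unfolding expo_embed_def lookup_sum by (rule sum.cong) (auto simp: lookup_single when_def)
  then show "coef (expo_embed u) (Some i) = coef u i" by (simp add: in_keys_iff)
  show "coef (expo_embed u) None = 0"
    unfolding expo_embed_def lookup_sum by (simp add: lookup_single)
qed

lemma mdeg_restr: "mdeg w = coef w None + mdeg (restr w)"
proof -
  have "mdeg w = (\<Sum>i\<in>UNIV. coef w i)" by (rule mdeg_superset) auto
  also have "\<dots> = coef w None + (\<Sum>i\<in>range Some. coef w i)"
    unfolding UNIV_option_conv by (subst sum.insert) auto
  also have "(\<Sum>i\<in>range Some. coef w i) = (\<Sum>i\<in>UNIV. coef (restr w) i)"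
    by (subst sum.reindex) auto
  also have "\<dots> = mdeg (restr w)" by (rule mdeg_superset[symmetric]) auto
  finally show ?thesis .
qed

text \<open>The exponent of index \<open>None\<close> fills the degree up to \<open>e\<close>. As
  the subtraction is truncated, the result has degree \<open>e\<close> only if
  \<open>mdeg u \<le> e\<close>.\<close>

definition lift_expo :: "nat \<Rightarrow> 'n expo \<Rightarrow> 'n option expo" where
  "lift_expo e u = expo_embed u + Poly_Mapping.single None (e - mdeg u)"

lemma restr_expo_embed_add [simp]: "restr (expo_embed u + Poly_Mapping.single None j) = u"
  by (rule poly_mapping_eqI) (simp add: lookup_add lookup_single)

lemma expo_option_eqI: "coef v None = coef w None \<Longrightarrow> restr v = restr w \<Longrightarrow> v = w"
proof (rule poly_mapping_eqI)
  fix k assume a: "coef v None = coef w None" "restr v = restr w"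
  show "coef v k = coef w k"
  proof (cases k)
    case (Some i)
    then show ?thesis using arg_cong[OF a(2), of "\<lambda>x. coef x i"] by simp
  qed (use a in simp)
qed

lemma lift_expo_eq_iff:
  assumes "mdeg u \<le> e"
  shows "lift_expo e u = w \<longleftrightarrow> mdeg w = e \<and> u = restr w"
proof
  show "mdeg w = e \<and> u = restr w" if "lift_expo e u = w"
    using that[symmetric] assms mdeg_restr[of "lift_expo e u"]
    by (simp add: lift_expo_def lookup_add)
  show "lift_expo e u = w" if "mdeg w = e \<and> u = restr w"
    using that assms mdeg_restr[of w]
    by (intro expo_option_eqI) (auto simp: lift_expo_def lookup_add)
qed

text \<open>The linear maps \<open>S\<^sub>\<le>\<^sub>e \<rightarrow> T\<^sub>e\<close>, extended by \<open>0\<close> to monomials of degree \<open>> e\<close>.  The same map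
  serves polynomials (with \<open>\<alpha>\<^sub>0\<close>) and divided powers (with \<open>x\<^sub>0\<close>).\<close>

definition homogenize :: "nat \<Rightarrow> ('n::finite expo \<Rightarrow>\<^sub>0 'k::comm_monoid_add) \<Rightarrow> ('n option expo \<Rightarrow>\<^sub>0 'k)" where
  "homogenize e f =
    (\<Sum>u\<in>{u\<in>Poly_Mapping.keys f. mdeg u \<le> e}. Poly_Mapping.single (lift_expo e u) (coef f u))"

text \<open>No condition on \<open>mdeg (restr w)\<close> remains, since the restriction never has
  larger degree than \<open>w\<close>.\<close>

lemma coef_homogenize: "coef (homogenize e f) w = (if mdeg w = e then coef f (restr w) else 0)"
proof -
  have "coef (homogenize e f) w = (\<Sum>u\<in>{u\<in>Poly_Mapping.keys f. mdeg u \<le> e}.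
      if u = restr w then (if mdeg w = e then coef f (restr w) else 0) else 0)"
    unfolding homogenize_def lookup_sum
    by (rule sum.cong) (auto simp: lookup_single when_def lift_expo_eq_iff)
  also have "\<dots> = (if mdeg w = e then coef f (restr w) else 0)"
    using mdeg_restr[of w] by (auto simp: in_keys_iff)
  finally show ?thesis .
qed

lemma homogenize_in_homog_part: "homogenize e f \<in> homog_part e"
  by (simp add: homog_part_iff coef_homogenize)

lemma homogenize_zero [simp]: "homogenize e 0 = 0"
  by (rule poly_mapping_eqI) (simp add: coef_homogenize)

lemma homogenize_add: "homogenize e (f + g) = homogenize e f + homogenize e g"
  by (rule poly_mapping_eqI) (simp add: coef_homogenize lookup_add)

lemma homogenize_pscale: "homogenize e (pscale c f) = pscale c (homogenize e f)"
  by (rule poly_mapping_eqI) (simp add: coef_homogenize lookup_pscale)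

lemma linear_homogenize: "plinear (homogenize e)"
  by unfold_locales (auto simp: homogenize_add homogenize_pscale)

lemma homogenize_eq_0_iff:
  assumes "f \<in> deg_le_part e"
  shows "homogenize e f = 0 \<longleftrightarrow> f = 0"
proof
  assume h: "homogenize e f = 0"
  show "f = 0"
  proof (rule poly_mapping_eqI)
    fix u
    show "coef f u = coef 0 u"
    proof (cases "mdeg u \<le> e")
      case True
      then have "mdeg (lift_expo e u) = e" "restr (lift_expo e u) = u"
        using lift_expo_eq_iff[OF True, of "lift_expo e u"] by simp_all
      then show ?thesis using arg_cong[OF h, of "\<lambda>x. coef x (lift_expo e u)"] by (simp add: coef_homogenize)
    qed (use assms in \<open>auto simp: deg_le_part_iff\<close>)
  qed
qed simp

section \<open>Dehomogenization and contraction\<close>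

text \<open>The substitution \<delta>. It may merge terms, but never two terms of equal degree, so
  it is injective on each homogeneous part.\<close>

definition dehomogenize :: "('n::finite option expo \<Rightarrow>\<^sub>0 'k::comm_monoid_add) \<Rightarrow> ('n expo \<Rightarrow>\<^sub>0 'k)" where
  "dehomogenize f = (\<Sum>w\<in>Poly_Mapping.keys f. Poly_Mapping.single (restr w) (coef f w))"

lemma dehomogenize_superset:
  assumes "finite A" "Poly_Mapping.keys f \<subseteq> A"
  shows "dehomogenize f = (\<Sum>w\<in>A. Poly_Mapping.single (restr w) (coef f w))"
  unfolding dehomogenize_def
  by (rule sum.mono_neutral_left) (use assms in \<open>auto simp: in_keys_iff\<close>)

lemma dehomogenize_single [simp]:
  "dehomogenize (Poly_Mapping.single w c) = Poly_Mapping.single (restr w) c"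
  by (simp add: dehomogenize_superset[of "{w}"])

lemma dehomogenize_zero [simp]: "dehomogenize 0 = 0"
  by (simp add: dehomogenize_def)

lemma dehomogenize_add: "dehomogenize (f + g) = dehomogenize f + dehomogenize g"
proof -
  let ?A = "Poly_Mapping.keys f \<union> Poly_Mapping.keys g"
  have "Poly_Mapping.keys (f + g) \<subseteq> ?A" by (rule Poly_Mapping.keys_add)
  then show ?thesis
    by (simp add: dehomogenize_superset[of ?A] lookup_add single_add sum.distrib)
qed

lemma dehomogenize_mult:
  "dehomogenize (f * g :: ('n::finite option, 'k::comm_ring_1) mpoly) = dehomogenize f * dehomogenize g"
proof (induction f rule: poly_mapping_add_induct)
  case (single u c)
  show ?case
    by (induction g rule: poly_mapping_add_induct)
      (auto simp: mult_single restr_add distrib_left dehomogenize_add)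
qed (simp add: distrib_right dehomogenize_add)

lemma pscale_single: "pscale c (Poly_Mapping.single u d) = Poly_Mapping.single u (c * d)"
  by (rule poly_mapping_eqI) (simp add: lookup_pscale lookup_single when_def)

lemma dehomogenize_pscale: "dehomogenize (pscale c f) = pscale c (dehomogenize f)"
  by (induction f rule: poly_mapping_add_induct)
    (auto simp: pscale_single pm.scale_right_distrib dehomogenize_add)

lemma linear_dehomogenize: "plinear dehomogenize"
  by unfold_locales (auto simp: dehomogenize_add dehomogenize_pscale)

lemma homogenize_sum: "homogenize e (\<Sum>x\<in>X. g x) = (\<Sum>x\<in>X. homogenize e (g x))"
  by (induction X rule: infinite_finite_induct) (auto simp: homogenize_add)

lemma dehomogenize_sum: "dehomogenize (\<Sum>x\<in>X. g x) = (\<Sum>x\<in>X. dehomogenize (g x))"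
  by (induction X rule: infinite_finite_induct) (auto simp: dehomogenize_add)

lemma homogenize_single:
  "homogenize e (Poly_Mapping.single u c) = (if mdeg u \<le> e then Poly_Mapping.single (lift_expo e u) c else 0)"
proof (rule poly_mapping_eqI)
  fix w
  show "coef (homogenize e (Poly_Mapping.single u c)) w
      = coef (if mdeg u \<le> e then Poly_Mapping.single (lift_expo e u) c else 0) w"
    using mdeg_restr[of w] by (auto simp: coef_homogenize lookup_single when_def lift_expo_eq_iff)
qed

lemma homogenize_dehomogenize:
  assumes "f \<in> homog_part e"
  shows "homogenize e (dehomogenize f) = f"
proof -
  have "homogenize e (dehomogenize f) = (\<Sum>w\<in>Poly_Mapping.keys f. Poly_Mapping.single w (coef f w))"
    unfolding dehomogenize_def homogenize_sum
  proof (rule sum.cong[OF refl])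
    fix w assume "w \<in> Poly_Mapping.keys f"
    then have w: "mdeg w = e" using assms by (simp add: homog_part_def)
    then have "mdeg (restr w) \<le> e" using mdeg_restr[of w] by simp
    then show "homogenize e (Poly_Mapping.single (restr w) (coef f w)) = Poly_Mapping.single w (coef f w)"
      using w lift_expo_eq_iff[of "restr w" e w] by (simp add: homogenize_single)
  qed
  then show ?thesis using poly_mapping_sum_singles[of f] by simp
qed

lemma dehomogenize_homogenize:
  assumes "f \<in> deg_le_part e"
  shows "dehomogenize (homogenize e f) = f"
proof -
  have "dehomogenize (homogenize e f) = (\<Sum>w\<in>Poly_Mapping.keys f. Poly_Mapping.single w (coef f w))"
    unfolding homogenize_def dehomogenize_sum
    by (rule sum.cong) (use assms in \<open>auto simp: deg_le_part_def lift_expo_def\<close>)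
  then show ?thesis using poly_mapping_sum_singles[of f] by simp
qed

lemma dehomogenize_in_deg_le_part:
  assumes "f \<in> homog_part e"
  shows "dehomogenize f \<in> deg_le_part e"
  unfolding deg_le_part_iff
proof (intro allI impI)
  fix u assume u: "coef (dehomogenize f) u \<noteq> 0"
  have "\<exists>w\<in>Poly_Mapping.keys f. restr w = u"
  proof (rule ccontr)
    assume "\<not> ?thesis"
    then have "coef (dehomogenize f) u = 0"
      unfolding dehomogenize_def lookup_sum by (intro sum.neutral) (auto simp: lookup_single when_def)
    with u show False by simp
  qed
  then obtain w where "w \<in> Poly_Mapping.keys f" "restr w = u" by blast
  then show "mdeg u \<le> e" using assms mdeg_restr[of w] by (auto simp: homog_part_def)
qed

lemma coef_contract_dehomogenize:
  "coef (dehomogenize \<theta> \<lrcorner> F) v = (\<Sum>u\<in>Poly_Mapping.keys \<theta>. coef \<theta> u * coef F (restr u + v))"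
  unfolding dehomogenize_def contract_sum_left lookup_sum coef_contract_single ..

text \<open>Since \<open>\<theta>\<close> is homogeneous of degree \<open>e\<close>, the condition
  \<open>mdeg (u + w) = d\<close> becomes \<open>e + mdeg w = d\<close>, which is independent of
  \<open>u\<close>. What remains is the coefficient of
  \<open>dehomogenize \<theta> \<lrcorner> F\<close> at \<open>restr w\<close>; for
  \<open>e > d\<close> no \<open>w\<close> qualifies.\<close>

lemma contract_homogenize:
  assumes "\<theta> \<in> homog_part e"
  shows "\<theta> \<lrcorner> homogenize d F = (if e \<le> d then homogenize (d - e) (dehomogenize \<theta> \<lrcorner> F) else 0)"
proof (rule poly_mapping_eqI)
  fix w
  have "coef (\<theta> \<lrcorner> homogenize d F) w
      = (\<Sum>u\<in>Poly_Mapping.keys \<theta>. if e + mdeg w = d then coef \<theta> u * coef F (restr u + restr w) else 0)"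
    unfolding coef_contract
    by (rule sum.cong) (use assms in \<open>auto simp: coef_homogenize restr_add homog_part_def\<close>)
  also have "\<dots> = (if e + mdeg w = d then coef (dehomogenize \<theta> \<lrcorner> F) (restr w) else 0)"
    unfolding coef_contract_dehomogenize by simp
  also have "\<dots> = coef (if e \<le> d then homogenize (d - e) (dehomogenize \<theta> \<lrcorner> F) else 0) w"
    by (auto simp: coef_homogenize)
  finally show "coef (\<theta> \<lrcorner> homogenize d F) w
      = coef (if e \<le> d then homogenize (d - e) (dehomogenize \<theta> \<lrcorner> F) else 0) w" .
qed

lemma contract_deg_le_part: "F \<in> deg_le_part d \<Longrightarrow> \<theta> \<lrcorner> F \<in> deg_le_part d"
  unfolding deg_le_part_iff
proof (intro allI impI)
  fix w assume F: "\<forall>u. coef F u \<noteq> 0 \<longrightarrow> mdeg u \<le> d" and w: "coef (\<theta> \<lrcorner> F) w \<noteq> 0"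
  obtain u where "coef \<theta> u * coef F (u + w) \<noteq> 0"
    using w unfolding coef_contract by (meson sum.neutral)
  then have "coef F (u + w) \<noteq> 0" by auto
  then have "mdeg (u + w) \<le> d" using F by blast
  then show "mdeg w \<le> d" by simp
qed

section \<open>Agreement with the homogenizations in the statement\<close>

lemma coef_embed: "coef (embed f) w = (if coef w None = 0 then coef f (restr w) else 0)"
proof -
  have e: "expo_embed u = w \<longleftrightarrow> coef w None = 0 \<and> u = restr w" for u
    using restr_expo_embed_add[of u 0] by (auto intro: expo_option_eqI)
  have "coef (embed f) w = (\<Sum>u\<in>Poly_Mapping.keys f.
      if u = restr w then (if coef w None = 0 then coef f (restr w) else 0) else 0)"
    unfolding embed_def lookup_sum
    by (rule sum.cong) (auto simp: lookup_single when_def e)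
  then show ?thesis by (auto simp: in_keys_iff)
qed

text \<open>As \<open>embed F\<close> does not involve the variable of index \<open>None\<close>, in
  each variable one of the two exponents is zero and the binomial coefficient is
  \<open>1\<close>.\<close>

lemma dp_mult_embed_var:
  fixes F :: "('n::finite, 'k::comm_ring_1) dpoly"
  shows
  "dp_mult (embed F) (dp_var None j) =
    (\<Sum>u\<in>Poly_Mapping.keys (embed F). Poly_Mapping.single (u + Poly_Mapping.single None j) (coef (embed F) u))"
proof -
  have "(of_nat (\<Prod>i\<in>Poly_Mapping.keys (u + Poly_Mapping.single None j).
      (coef u i + coef (Poly_Mapping.single None j) i) choose coef u i) :: 'k) = 1"
    if "u \<in> Poly_Mapping.keys (embed F)" for u
  proof -
    have u0: "coef u None = 0" using that coef_embed[of F u] by (auto simp: in_keys_iff split: if_splits)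
    have "(coef u i + coef (Poly_Mapping.single None j) i) choose coef u i = 1" for i
      using u0 by (cases i) (auto simp: lookup_single)
    then show ?thesis by simp
  qed
  then show ?thesis
    unfolding dp_mult_def dp_var_def by simp
qed

lemma coef_dp_mult_embed_var:
  "coef (dp_mult (embed F) (dp_var None j)) w = (if coef w None = j then coef F (restr w) else 0)"
proof -
  let ?v = "expo_embed (restr w)"
  have r: "restr ?v = restr w" using restr_expo_embed_add[of "restr w" 0] by simp
  have *: "u + Poly_Mapping.single None j = w \<longleftrightarrow> coef w None = j \<and> u = ?v"
    if "u \<in> Poly_Mapping.keys (embed F)" for u
  proof -
    have u0: "coef u None = 0" using that coef_embed[of F u] by (auto simp: in_keys_iff split: if_splits)
    have rr: "restr (u + Poly_Mapping.single None j) = restr u"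
      by (rule poly_mapping_eqI) (simp add: lookup_add lookup_single)
    show ?thesis
    proof
      assume a: "u + Poly_Mapping.single None j = w"
      have "coef w None = j" unfolding a[symmetric] using u0 by (simp add: lookup_add)
      moreover have "u = ?v" by (rule expo_option_eqI) (use u0 r rr a in simp_all)
      ultimately show "coef w None = j \<and> u = ?v" by simp
    next
      assume "coef w None = j \<and> u = ?v"
      then show "u + Poly_Mapping.single None j = w"
        by (intro expo_option_eqI) (use rr r in \<open>auto simp: lookup_add\<close>)
    qed
  qed
  have "coef (dp_mult (embed F) (dp_var None j)) w = (\<Sum>u\<in>Poly_Mapping.keys (embed F).
      if u = ?v then (if coef w None = j then coef (embed F) ?v else 0) else 0)"
    unfolding dp_mult_embed_var lookup_sum
    by (rule sum.cong) (auto simp: lookup_single when_def *)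
  also have "\<dots> = (if coef w None = j then coef (embed F) ?v else 0)" by (auto simp: in_keys_iff)
  also have "coef (embed F) ?v = coef F (restr w)" by (simp add: coef_embed r)
  finally show ?thesis .
qed

lemma sum_dp_mult_eq_homogenize:
  assumes "\<forall>i. F i \<in> homog_part i"
  shows "(\<Sum>i\<le>d1. dp_mult (embed (F i)) (dp_var None (d1 + d2 - i))) = homogenize (d1 + d2) (\<Sum>i\<le>d1. F i)"
proof (rule poly_mapping_eqI)
  fix w
  have "coef (dp_mult (embed (F i)) (dp_var None (d1 + d2 - i))) w
      = (if mdeg w = d1 + d2 then coef (F i) (restr w) else 0)" if "i \<le> d1" for i
  proof (cases "coef (F i) (restr w) = 0")
    case False
    then have "mdeg (restr w) = i" using assms by (simp add: homog_part_iff)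
    \<comment> \<open>Because \<open>i \<le> d1\<close>, the subtraction \<open>d1 + d2 - i\<close>
      is exact: the exponent of index \<open>None\<close> has this value iff \<open>w\<close> has
      degree \<open>d1 + d2\<close>.\<close>
    then show ?thesis using that mdeg_restr[of w] by (auto simp: coef_dp_mult_embed_var)
  qed (simp add: coef_dp_mult_embed_var)
  then show "coef (\<Sum>i\<le>d1. dp_mult (embed (F i)) (dp_var None (d1 + d2 - i))) w
      = coef (homogenize (d1 + d2) (\<Sum>i\<le>d1. F i)) w"
    by (simp add: lookup_sum coef_homogenize)
qed

lemma sum_hcomp_deg_le:
  assumes "f \<in> deg_le_part d"
  shows "(\<Sum>i\<le>d. hcomp i f) = f"
proof (rule poly_mapping_eqI)
  fix u
  have "coef (\<Sum>i\<le>d. hcomp i f) u = (\<Sum>i\<le>d. if i = mdeg u then coef f u else 0)"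
    unfolding lookup_sum by (rule sum.cong) (auto simp: coef_hcomp)
  also have "\<dots> = coef f u" using assms by (auto simp: deg_le_part_iff)
  finally show "coef (\<Sum>i\<le>d. hcomp i f) u = coef f u" .
qed

lemma space_hom_eq_image:
  assumes "W \<subseteq> deg_le_part d1"
  shows "space_hom d1 d2 W = homogenize (d1 + d2) ` W"
proof
  show "space_hom d1 d2 W \<subseteq> homogenize (d1 + d2) ` W"
    unfolding space_hom_def using sum_dp_mult_eq_homogenize by blast
  show "homogenize (d1 + d2) ` W \<subseteq> space_hom d1 d2 W"
  proof
    fix G assume "G \<in> homogenize (d1 + d2) ` W"
    then obtain f where f: "f \<in> W" "G = homogenize (d1 + d2) f" by blast
    have "\<forall>i. hcomp i f \<in> homog_part i" by (simp add: hcomp_in_homog_part)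
    moreover have "(\<Sum>i\<le>d1. hcomp i f) = f" using f(1) assms by (intro sum_hcomp_deg_le) auto
    ultimately show "G \<in> space_hom d1 d2 W"
      unfolding space_hom_def using f sum_dp_mult_eq_homogenize[of "\<lambda>i. hcomp i f" d1 d2]
      by (intro CollectI exI[of _ "\<lambda>i. hcomp i f"]) auto
  qed
qed

text \<open>Multiplying \<open>embed g\<close> by a power of \<open>\<alpha>\<^sub>0\<close> gives
  the same coefficients as the divided power product of \<open>dp_mult_embed_var\<close>, so the
  formula proved for the latter carries over.\<close>

lemma poly_hom_eq_homogenize:
  fixes f :: "('n::finite, 'k::comm_ring_1) mpoly"
  shows "poly_hom f = homogenize (total_deg f) f"
proof -
  have mv: "mvar None ^ j = (Poly_Mapping.single (Poly_Mapping.single None j) 1 :: ('n option, 'k) mpoly)" for j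
    by (induction j) (auto simp: mvar_def mult_single single_add[symmetric])
  have *: "coef (embed g * mvar None ^ j) w = (if coef w None = j then coef g (restr w) else 0)"
    for g :: "('n, 'k) mpoly" and j w
  proof -
    have "embed g * mvar None ^ j = (\<Sum>u\<in>Poly_Mapping.keys (embed g).
       Poly_Mapping.single u (coef (embed g) u)) * Poly_Mapping.single (Poly_Mapping.single None j) 1"
      using poly_mapping_sum_singles[of "embed g"] by (simp add: mv)
    also have "\<dots> = dp_mult (embed g) (dp_var None j)"
      unfolding dp_mult_embed_var sum_distrib_right by (simp add: mult_single)
    finally show ?thesis by (simp add: coef_dp_mult_embed_var)
  qed
  have f: "f \<in> deg_le_part (total_deg f)"
    unfolding deg_le_part_def total_deg_def by simp
  show ?thesis
  proof (rule poly_mapping_eqI)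
    fix w
    have "coef (poly_hom f) w = (\<Sum>i\<le>total_deg f. if i = mdeg (restr w)
        then (if mdeg w = total_deg f then coef f (restr w) else 0) else 0)"
      unfolding poly_hom_def lookup_sum *
      by (rule sum.cong) (use mdeg_restr[of w] in \<open>auto simp: coef_hcomp\<close>)
    also have "\<dots> = (if mdeg w = total_deg f then coef f (restr w) else 0)"
      using f mdeg_restr[of w] by (auto simp: deg_le_part_iff)
    finally show "coef (poly_hom f) w = coef (homogenize (total_deg f) f) w"
      by (simp add: coef_homogenize)
  qed
qed

section \<open>The homogenized annihilator\<close>

text \<open>The homogenized ideal (see \<open>ideal_hom_eq_hom_of\<close>) as a membership test on
  homogeneous components. Testing \<open>dehomogenize f\<close> alone would be too weak:
  \<open>\<alpha>\<^sub>0 - 1\<close> is sent to \<open>0\<close>.\<close>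

definition hom_of :: "('n::finite, 'k::comm_ring_1) mpoly set \<Rightarrow> ('n option, 'k) mpoly set" where
  "hom_of A = {f. \<forall>e. dehomogenize (hcomp e f) \<in> A}"

lemma is_ideal_hom_of:
  assumes A: "is_ideal A"
  shows "is_ideal (hom_of A)"
proof (rule is_idealI)
  show "0 \<in> hom_of A" using A by (simp add: hom_of_def is_ideal_iff)
  show "f + g \<in> hom_of A" if "f \<in> hom_of A" "g \<in> hom_of A" for f g
    using that A by (simp add: hom_of_def is_ideal_iff hcomp_add dehomogenize_add)
  show "Poly_Mapping.single u c * f \<in> hom_of A" if "f \<in> hom_of A" for u c f
    using that A by (simp add: hom_of_def is_ideal_iff hcomp_single_mult dehomogenize_mult)
qed

lemma homog_mem_hom_of_iff:
  assumes "is_ideal A" "f \<in> homog_part e"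
  shows "f \<in> hom_of A \<longleftrightarrow> dehomogenize f \<in> A"
  using assms by (auto simp: hom_of_def hcomp_homog is_ideal_iff)

lemma homogeneous_ideal_hom_of:
  assumes "is_ideal A"
  shows "homogeneous_ideal (hom_of A)"
  unfolding homogeneous_ideal_def
proof (intro conjI ballI allI)
  fix f e assume "f \<in> hom_of A"
  then show "hcomp e f \<in> hom_of A"
    unfolding homog_mem_hom_of_iff[OF assms hcomp_in_homog_part] by (simp add: hom_of_def)
qed (rule is_ideal_hom_of[OF assms])

lemma homog_part_dehomogenize_inj:
  assumes "f \<in> homog_part e" "g \<in> homog_part e" "dehomogenize f = dehomogenize g"
  shows "f = g"
  using assms by (metis homogenize_dehomogenize)

lemma in_deg_le_total_deg: "f \<in> deg_le_part (total_deg f)"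
  by (simp add: deg_le_part_def total_deg_def)

lemma total_deg_le: "f \<in> deg_le_part e \<Longrightarrow> total_deg f \<le> e"
  by (simp add: deg_le_part_def total_deg_def)

lemma restr_single_None [simp]: "restr (Poly_Mapping.single None j) = 0"
  by (rule poly_mapping_eqI) (simp add: lookup_single)

text \<open>Both sides are homogeneous of degree \<open>e\<close> and agree after
  dehomogenization.\<close>

lemma homogenize_higher:
  fixes f :: "('n::finite, 'k::comm_ring_1) mpoly"
  assumes "f \<in> deg_le_part D" "D \<le> e"
  shows "homogenize e f = Poly_Mapping.single (Poly_Mapping.single None (e - D)) 1 * homogenize D f"
proof (rule homog_part_dehomogenize_inj[of _ e])
  show "homogenize e f \<in> homog_part e" by (rule homogenize_in_homog_part)
  have "Poly_Mapping.single (Poly_Mapping.single None (e - D)) 1 * homogenize D f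
      \<in> homog_part (mdeg (Poly_Mapping.single (None :: 'n option) (e - D)) + D)"
    by (rule homog_part_single_mult) (rule homogenize_in_homog_part)
  then show "Poly_Mapping.single (Poly_Mapping.single None (e - D)) 1 * homogenize D f \<in> homog_part e"
    using assms(2) by simp
  have "f \<in> deg_le_part e" using assms by (force simp: deg_le_part_def)
  then show "dehomogenize (homogenize e f) =
    dehomogenize (Poly_Mapping.single (Poly_Mapping.single None (e - D)) 1 * homogenize D f)"
    using assms(1) by (simp add: dehomogenize_mult dehomogenize_homogenize)
qed

text \<open>Each homogeneous component of an element of \<open>hom_of A\<close> is a power of
  \<open>\<alpha>\<^sub>0\<close> times the homogenization of its dehomogenization.\<close>

lemma ideal_hom_eq_hom_of:
  assumes A: "is_ideal A"
  shows "ideal_hom A = hom_of A"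
proof
  show "ideal_hom A \<subseteq> hom_of A"
    unfolding ideal_hom_def
  proof (rule ideal_gen_minimal[OF _ is_ideal_hom_of[OF A]], safe)
    fix f assume "f \<in> A"
    then show "poly_hom f \<in> hom_of A"
      unfolding poly_hom_eq_homogenize homog_mem_hom_of_iff[OF A homogenize_in_homog_part]
      by (simp add: dehomogenize_homogenize in_deg_le_total_deg)
  qed
  have id: "is_ideal (ideal_hom A)" unfolding ideal_hom_def by (rule is_ideal_ideal_gen)
  show "hom_of A \<subseteq> ideal_hom A"
  proof
    fix f assume f: "f \<in> hom_of A"
    show "f \<in> ideal_hom A"
    proof (rule ideal_mem_if_hcomp_mem[OF id])
      fix e
      let ?h = "dehomogenize (hcomp e f)"
      have "?h \<in> A" using f by (simp add: hom_of_def)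
      then have "poly_hom ?h \<in> ideal_hom A"
        unfolding ideal_hom_def using ideal_gen_superset by blast
      \<comment> \<open>The degree drops by the power of \<open>\<alpha>\<^sub>0\<close> that
        divides the component; this power is the factor restored below.\<close>
      moreover have "total_deg ?h \<le> e"
        by (intro total_deg_le dehomogenize_in_deg_le_part hcomp_in_homog_part)
      then have "hcomp e f = Poly_Mapping.single (Poly_Mapping.single None (e - total_deg ?h)) 1 * poly_hom ?h"
        unfolding poly_hom_eq_homogenize
        using homogenize_higher[OF in_deg_le_total_deg, of ?h e]
          homogenize_dehomogenize[OF hcomp_in_homog_part, of e f] by simp
      ultimately show "hcomp e f \<in> ideal_hom A" using id by (metis is_ideal_iff)
    qed
  qed
qed

section \<open>Saturatedness of the homogenized ideal\<close>

lemma var_power_mem_ideal_power: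
  "Poly_Mapping.single (Poly_Mapping.single i N) 1 \<in>
    ideal_power (irrelevant_ideal :: ('i, 'k::comm_ring_1) mpoly set) N"
proof (induction N)
  case (Suc N)
  let ?v = "\<lambda>j. Poly_Mapping.single (Poly_Mapping.single i j) 1 :: ('i, 'k) mpoly"
  have "?v (Suc N) = mvar i * ?v N"
    by (simp add: mvar_def mult_single single_add[symmetric])
  moreover have "mvar i \<in> (irrelevant_ideal :: ('i, 'k) mpoly set)"
    unfolding irrelevant_ideal_def using ideal_gen_superset by blast
  ultimately have "?v (Suc N) \<in> {f * g | f g. f \<in> irrelevant_ideal \<and> g \<in> ideal_power irrelevant_ideal N}"
    using Suc by blast
  then show ?case unfolding ideal_power.simps by (rule subsetD[OF ideal_gen_superset])
qed simp

lemma ideal_mult_right: "is_ideal I \<Longrightarrow> x \<in> I \<Longrightarrow> x * c \<in> I"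
  by (simp add: is_ideal_iff mult.commute)

lemma saturation_superset: "is_ideal J \<Longrightarrow> J \<subseteq> saturation J"
  unfolding saturation_def by (auto intro!: exI[of _ 0] ideal_mult_right)

text \<open>Multiplication by a power of \<open>\<alpha>\<^sub>0\<close> shifts the components and
  leaves their dehomogenizations unchanged.\<close>

lemma mem_hom_of_if_shift_mem:
  assumes A: "is_ideal A"
    and s: "\<And>e. dehomogenize (hcomp (e + N) (Poly_Mapping.single (Poly_Mapping.single None N) 1 * f)) \<in> A"
  shows "f \<in> hom_of A"
  unfolding hom_of_def
proof (intro CollectI allI)
  fix e
  show "dehomogenize (hcomp e f) \<in> A"
    using s[of e] by (simp add: hcomp_single_mult dehomogenize_mult)
qed

text \<open>By \<open>mem_hom_of_if_shift_mem\<close>, \<open>\<alpha>\<^sub>0\<close> is a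
  nonzerodivisor modulo \<open>hom_of A\<close>, and its \<open>N\<close>-th power lies in the
  \<open>N\<close>-th power of the irrelevant ideal.\<close>

lemma saturation_hom_of:
  assumes A: "is_ideal A"
  shows "saturation (hom_of A) = hom_of A"
proof
  show "saturation (hom_of A) \<subseteq> hom_of A"
  proof
    fix f assume "f \<in> saturation (hom_of A)"
    then obtain N where "\<forall>g\<in>ideal_power irrelevant_ideal N. f * g \<in> hom_of A"
      unfolding saturation_def by blast
    then have "f * Poly_Mapping.single (Poly_Mapping.single None N) 1 \<in> hom_of A"
      by (rule bspec) (rule var_power_mem_ideal_power)
    then show "f \<in> hom_of A"
      by (intro mem_hom_of_if_shift_mem[OF A]) (auto simp: hom_of_def mult.commute)
  qed
qed (rule saturation_superset[OF is_ideal_hom_of[OF A]])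

section \<open>Hilbert function of the homogenized annihilator\<close>

lemma coef_dehomogenize_homogenize:
  "coef (dehomogenize (homogenize e f)) u = (if mdeg u \<le> e then coef f u else 0)"
proof -
  have "dehomogenize (homogenize e f) = (\<Sum>v\<in>{v\<in>Poly_Mapping.keys f. mdeg v \<le> e}. Poly_Mapping.single v (coef f v))"
    unfolding homogenize_def dehomogenize_sum by (simp add: lift_expo_def)
  then have "coef (dehomogenize (homogenize e f)) u
      = (\<Sum>v\<in>{v\<in>Poly_Mapping.keys f. mdeg v \<le> e}. if v = u then coef f u else 0)"
    unfolding lookup_sum by (auto simp: lookup_single when_def lookup_sum intro!: sum.cong)
  then show ?thesis by (auto simp: in_keys_iff)
qed

lemma contract_high_degree:
  assumes "F \<in> deg_le_part d" "\<And>u. coef \<theta> u \<noteq> 0 \<Longrightarrow> d < mdeg u"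
  shows "\<theta> \<lrcorner> F = 0"
proof (rule poly_mapping_eqI)
  fix w
  have "coef \<theta> u * coef F (u + w) = 0" for u
  proof (rule ccontr)
    assume "coef \<theta> u * coef F (u + w) \<noteq> 0"
    then have "coef \<theta> u \<noteq> 0" "coef F (u + w) \<noteq> 0" by auto
    then have "d < mdeg u" "mdeg (u + w) \<le> d" using assms unfolding deg_le_part_iff by blast+
    then show False by simp
  qed
  then show "coef (\<theta> \<lrcorner> F) w = coef 0 w" by (simp add: coef_contract)
qed

text \<open>Homogenizing and dehomogenizing truncates \<open>f\<close> at degree \<open>e\<close>.
  For \<open>e \<ge> d1\<close> the removed terms have degree above \<open>d1\<close> and annihilate
  \<open>W\<close>.\<close>

lemma homogenize_mem_hom_of_iff:
  assumes W: "W \<subseteq> deg_le_part d1" and e: "d1 \<le> e"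
  shows "homogenize e f \<in> hom_of (Ann W) \<longleftrightarrow> f \<in> Ann W"
proof -
  let ?g = "dehomogenize (homogenize e f)"
  have d: "f - ?g \<in> Ann W"
    unfolding Ann_def
  proof (intro CollectI ballI)
    fix F assume "F \<in> W"
    then show "(f - ?g) \<lrcorner> F = 0"
      using W e by (intro contract_high_degree[of F d1])
        (auto simp: lookup_minus coef_dehomogenize_homogenize split: if_splits)
  qed
  have "f \<in> Ann W \<longleftrightarrow> ?g \<in> Ann W"
  proof
    show "?g \<in> Ann W" if "f \<in> Ann W" using ideal_diff[OF is_ideal_Ann that d] by simp
    show "f \<in> Ann W" if "?g \<in> Ann W"
    proof -
      have "(f - ?g) + ?g \<in> Ann W" using that d is_ideal_Ann[of W] unfolding is_ideal_iff by blast
      then show ?thesis by simp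
    qed
  qed
  then show ?thesis
    unfolding homog_mem_hom_of_iff[OF is_ideal_Ann homogenize_in_homog_part] by simp
qed

lemma subspace_Ann: "pm.subspace (Ann (W :: ('i, 'k::field) dpoly set))"
  by (rule ideal_subspace) (rule is_ideal_Ann)

text \<open>By \<open>homogenize_mem_hom_of_iff\<close>, \<open>homogenize e\<close> embeds the
  quotient by \<open>Ann W\<close> into the degree \<open>e\<close> part of the quotient by
  \<open>hom_of (Ann W)\<close>. This also yields finiteness, so that
  \<open>quotient_dim UNIV (Ann W)\<close> is a true dimension.\<close>

lemma fin_quotient_Ann:
  fixes W :: "('n::finite, 'k::field) dpoly set"
  assumes "W \<subseteq> deg_le_part d1" "d1 \<le> e"
  shows "fin_quotient UNIV (Ann W)" "quotient_dim UNIV (Ann W) \<le> hilbert_fun (hom_of (Ann W)) e"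
proof -
  have fq: "fin_quotient (homog_part e) (hom_of (Ann W) \<inter> homog_part e)"
    by (rule fin_quotient_homog_part) (intro ideal_subspace is_ideal_hom_of is_ideal_Ann)
  have "x \<in> Ann W" if "homogenize e x \<in> hom_of (Ann W) \<inter> homog_part e" for x
    using that homogenize_mem_hom_of_iff[OF assms] by blast
  then have inj: "\<And>x. x \<in> UNIV \<Longrightarrow> homogenize e x \<in> hom_of (Ann W) \<inter> homog_part e \<Longrightarrow> x \<in> Ann W"
    by blast
  have im: "range (homogenize e) \<subseteq> homog_part e" using homogenize_in_homog_part by blast
  note q = quotient_dim_le[OF fq pm.subspace_UNIV subspace_Ann subset_UNIV linear_homogenize im inj]
  show "fin_quotient UNIV (Ann W)" by (rule q(1))
  show "quotient_dim UNIV (Ann W) \<le> hilbert_fun (hom_of (Ann W)) e"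
    unfolding hilbert_fun_def by (rule q(2))
qed

text \<open>Dehomogenization gives the embedding opposite to that of
  \<open>fin_quotient_Ann\<close>.\<close>

lemma hilbert_fun_hom_of_Ann:
  fixes W :: "('n::finite, 'k::field) dpoly set"
  assumes "W \<subseteq> deg_le_part d1" "d1 \<le> e"
  shows "hilbert_fun (hom_of (Ann W)) e = quotient_dim UNIV (Ann W)"
proof (rule antisym)
  show "hilbert_fun (hom_of (Ann W)) e \<le> quotient_dim UNIV (Ann W)"
    unfolding hilbert_fun_def
  proof (rule quotient_dim_le(2)[OF fin_quotient_Ann(1)[OF assms] subspace_homog_part])
    show "pm.subspace (hom_of (Ann W) \<inter> homog_part e)"
      by (intro pm.subspace_inter ideal_subspace is_ideal_hom_of is_ideal_Ann subspace_homog_part)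
    show "plinear (dehomogenize :: _ \<Rightarrow> ('n, 'k) mpoly)" by (rule linear_dehomogenize)
    show "x \<in> hom_of (Ann W) \<inter> homog_part e" if "x \<in> homog_part e" "dehomogenize x \<in> Ann W" for x
      using that homog_mem_hom_of_iff[OF is_ideal_Ann] by blast
  qed auto
qed (rule fin_quotient_Ann(2)[OF assms])

text \<open>As the quotient is finite-dimensional, the value \<open>0\<close> would mean an empty
  basis; then \<open>1\<close> would annihilate \<open>W\<close>.\<close>

lemma quotient_dim_Ann_pos:
  fixes W :: "('n::finite, 'k::field) dpoly set"
  assumes "W \<subseteq> deg_le_part d1" "pm.subspace W" "W \<noteq> {0}"
  shows "0 < quotient_dim UNIV (Ann W)"
proof (rule ccontr)
  assume "\<not> ?thesis"
  then have "quotient_dim UNIV (Ann W) = 0" by simp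
  moreover obtain C where "quotient_basis UNIV (Ann W) C" "finite C" "quotient_dim UNIV (Ann W) = card C"
    using fin_quotient_basis[OF fin_quotient_Ann(1)[OF assms(1) le_refl]] .
  ultimately have "quotient_basis UNIV (Ann W) {}" by simp
  then have "1 \<in> Ann W" by (auto simp: quotient_basis_def)
  moreover have "1 \<lrcorner> F = F" for F :: "('n, 'k) dpoly"
    using coef_contract_single[of 0 1 F] by (intro poly_mapping_eqI) simp
  ultimately have "W \<subseteq> {0}" by (auto simp: Ann_def)
  then show False using assms(2,3) pm.subspace_0 by blast
qed

section \<open>Comparison with the annihilator of the homogenized space\<close>

text \<open>Both directions are \<open>contract_homogenize\<close>. The second cancels
  \<open>homogenize (d - e)\<close>, which is injective on degree at most \<open>d1\<close> because
  \<open>d1 \<le> d - e\<close>.\<close>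

lemma homog_mem_Ann_homogenize:
  assumes W: "W \<subseteq> deg_le_part d1" and \<theta>: "\<theta> \<in> homog_part e"
  shows "\<theta> \<in> hom_of (Ann W) \<Longrightarrow> \<theta> \<in> Ann (homogenize d ` W)"
    and "\<theta> \<in> Ann (homogenize d ` W) \<Longrightarrow> d1 + e \<le> d \<Longrightarrow> \<theta> \<in> hom_of (Ann W)"
proof -
  show "\<theta> \<in> Ann (homogenize d ` W)" if "\<theta> \<in> hom_of (Ann W)"
    using that unfolding homog_mem_hom_of_iff[OF is_ideal_Ann \<theta>]
    by (auto simp: Ann_def contract_homogenize[OF \<theta>])
  show "\<theta> \<in> hom_of (Ann W)" if a: "\<theta> \<in> Ann (homogenize d ` W)" and d: "d1 + e \<le> d"
  proof -
    have "dehomogenize \<theta> \<lrcorner> F = 0" if F: "F \<in> W" for F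
    proof -
      have "F \<in> deg_le_part (d - e)" using F W d by (force simp: deg_le_part_def)
      then have "dehomogenize \<theta> \<lrcorner> F \<in> deg_le_part (d - e)" by (rule contract_deg_le_part)
      moreover have "homogenize (d - e) (dehomogenize \<theta> \<lrcorner> F) = 0"
        using a d F by (auto simp: Ann_def contract_homogenize[OF \<theta>])
      ultimately show "dehomogenize \<theta> \<lrcorner> F = 0" using homogenize_eq_0_iff by blast
    qed
    then show ?thesis unfolding homog_mem_hom_of_iff[OF is_ideal_Ann \<theta>] by (simp add: Ann_def)
  qed
qed

lemma hom_of_Ann_subset:
  assumes "W \<subseteq> deg_le_part d1"
  shows "hom_of (Ann W) \<subseteq> Ann (homogenize d ` W)"
proof
  fix f assume "f \<in> hom_of (Ann W)"
  then have "hcomp e f \<in> hom_of (Ann W)" for e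
    using homogeneous_ideal_hom_of[OF is_ideal_Ann] unfolding homogeneous_ideal_def by blast
  then have "hcomp e f \<in> Ann (homogenize d ` W)" for e
    by (rule homog_mem_Ann_homogenize(1)[OF assms hcomp_in_homog_part])
  then show "f \<in> Ann (homogenize d ` W)" by (rule ideal_mem_if_hcomp_mem[OF is_ideal_Ann])
qed

lemma hom_of_Ann_part_eq:
  assumes "W \<subseteq> deg_le_part d1" "d1 + e \<le> d"
  shows "Ann (homogenize d ` W) \<inter> homog_part e = hom_of (Ann W) \<inter> homog_part e"
  using homog_mem_Ann_homogenize[OF assms(1), of _ e d] assms(2) by blast

lemma hilbert_fun_antimono:
  fixes I J :: "('i::finite, 'k::field) mpoly set"
  assumes "pm.subspace I" "pm.subspace J" "I \<inter> homog_part e \<subseteq> J"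
  shows "hilbert_fun J e \<le> hilbert_fun I e"
    and "hilbert_fun I e \<le> hilbert_fun J e \<Longrightarrow> J \<inter> homog_part e = I \<inter> homog_part e"
proof -
  have sJ: "pm.subspace (J \<inter> homog_part e)"
    using assms(2) subspace_homog_part by (rule pm.subspace_inter)
  have sub: "I \<inter> homog_part e \<subseteq> J \<inter> homog_part e" using assms(3) by blast
  note q = quotient_dim_antimono[OF fin_quotient_homog_part[OF assms(1)] sJ sub]
  show le: "hilbert_fun J e \<le> hilbert_fun I e" unfolding hilbert_fun_def using q(2) by blast
  show "J \<inter> homog_part e = I \<inter> homog_part e" if "hilbert_fun I e \<le> hilbert_fun J e"
    using q(3) le_antisym[OF that le] unfolding hilbert_fun_def by simp
qed

text \<open>In this range of \<open>e\<close> the ideal \<open>hom_of (Ann W)\<close> has constant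
  codimension and contains the degree \<open>e\<close> part of \<open>J\<close>. For
  \<open>d = d1 + d2\<close> the range contains \<open>d1\<close> iff \<open>d1 \<le> d2\<close>,
  and \<open>Suc d1\<close> iff \<open>d1 + 1 \<le> d2\<close>: these are the bounds in (ii) and
  (iii).\<close>

lemma hilbert_fun_ge:
  fixes W :: "('n::finite, 'k::field) dpoly set"
  assumes W: "W \<subseteq> deg_le_part d1" and J: "is_ideal J" "J \<subseteq> Ann (homogenize d ` W)"
    and e: "d1 \<le> e" "d1 + e \<le> d"
  shows "quotient_dim UNIV (Ann W) \<le> hilbert_fun J e"
    and "hilbert_fun J e \<le> quotient_dim UNIV (Ann W) \<Longrightarrow> J \<inter> homog_part e = hom_of (Ann W) \<inter> homog_part e"
proof -
  have s: "pm.subspace (hom_of (Ann W))" by (intro ideal_subspace is_ideal_hom_of is_ideal_Ann)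
  have sub: "J \<inter> homog_part e \<subseteq> hom_of (Ann W)" using J(2) hom_of_Ann_part_eq[OF W e(2)] by blast
  note h = hilbert_fun_antimono[OF ideal_subspace[OF J(1)] s sub] hilbert_fun_hom_of_Ann[OF W e(1)]
  show "quotient_dim UNIV (Ann W) \<le> hilbert_fun J e" using h(1,3) by simp
  show "J \<inter> homog_part e = hom_of (Ann W) \<inter> homog_part e"
    if "hilbert_fun J e \<le> quotient_dim UNIV (Ann W)" using h(2,3) that by simp
qed

section \<open>Generation in high degrees\<close>

lemma expo_split:
  assumes "coef u i \<noteq> (0::nat)"
  shows "u = Poly_Mapping.single i 1 + (u - Poly_Mapping.single i 1)"
  by (rule poly_mapping_eqI) (use assms in \<open>auto simp: lookup_add lookup_minus lookup_single when_def\<close>)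

lemma high_monomial_mem_hom_of_Ann:
  assumes "W \<subseteq> deg_le_part d1" "coef u None = 0" "d1 < mdeg u"
  shows "Poly_Mapping.single u c \<in> hom_of (Ann W)"
proof -
  have h: "Poly_Mapping.single u c \<in> homog_part (mdeg u)" by (auto simp: homog_part_def)
  have "d1 < mdeg (restr u)" using assms(2,3) mdeg_restr[of u] by simp
  then have "Poly_Mapping.single (restr u) c \<in> Ann W"
    using assms(1) by (auto simp: Ann_def lookup_single when_def split: if_splits intro!: contract_high_degree[of _ d1])
  then show ?thesis unfolding homog_mem_hom_of_iff[OF is_ideal_Ann h] by simp
qed

text \<open>An element of degree \<open>Suc e\<close> is split as \<open>f0 + mvar None * g\<close>,
  where \<open>f0\<close> collects the terms without \<open>\<alpha>\<^sub>0\<close>. Each term of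
  \<open>f0\<close> is a variable times a monomial of degree \<open>e > d1\<close>, again in the
  ideal, and \<open>g\<close> is in the ideal because \<delta> does not see the factor
  \<open>\<alpha>\<^sub>0\<close>.\<close>

lemma hom_of_Ann_generated:
  fixes W :: "('n::finite, 'k::field) dpoly set"
  assumes W: "W \<subseteq> deg_le_part d1" and J: "is_ideal J" and base: "hom_of (Ann W) \<inter> homog_part (Suc d1) \<subseteq> J"
    and e: "Suc d1 \<le> e"
  shows "hom_of (Ann W) \<inter> homog_part e \<subseteq> J"
  using e
proof (induction e rule: dec_induct)
  case base
  show ?case by (rule assms(3))
next
  case (step e)
  let ?I = "hom_of (Ann W)"
  have I: "is_ideal ?I" by (intro is_ideal_hom_of is_ideal_Ann)
  show ?case
  proof
    fix f assume f: "f \<in> ?I \<inter> homog_part (Suc e)"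
    define K0 where "K0 = {u\<in>Poly_Mapping.keys f. coef u None = 0}"
    define K1 where "K1 = {u\<in>Poly_Mapping.keys f. coef u None \<noteq> 0}"
    define f0 where "f0 = (\<Sum>u\<in>K0. Poly_Mapping.single u (coef f u))"
    define g where "g = (\<Sum>u\<in>K1. Poly_Mapping.single (u - Poly_Mapping.single None 1) (coef f u))"
    have deg: "mdeg u = Suc e" if "u \<in> Poly_Mapping.keys f" for u
      using f that by (auto simp: homog_part_def)
    have "(\<Sum>u\<in>K1. Poly_Mapping.single u (coef f u)) = mvar None * g"
      unfolding g_def sum_distrib_left mvar_def
    proof (rule sum.cong[OF refl])
      fix u assume "u \<in> K1"
      then show "Poly_Mapping.single u (coef f u) = Poly_Mapping.single (Poly_Mapping.single None 1) 1
          * Poly_Mapping.single (u - Poly_Mapping.single None 1) (coef f u)"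
        using expo_split[of u None] by (simp add: mult_single K1_def)
    qed
    moreover have "f = f0 + (\<Sum>u\<in>K1. Poly_Mapping.single u (coef f u))"
    proof -
      have "Poly_Mapping.keys f = K0 \<union> K1" "K0 \<inter> K1 = {}" "finite K0" "finite K1"
        by (auto simp: K0_def K1_def)
      then have "f0 + (\<Sum>u\<in>K1. Poly_Mapping.single u (coef f u))
          = (\<Sum>u\<in>Poly_Mapping.keys f. Poly_Mapping.single u (coef f u))"
        unfolding f0_def by (simp add: sum.union_disjoint)
      with poly_mapping_sum_singles[of f] show ?thesis by (rule trans[OF _ sym])
    qed
    ultimately have split: "f = f0 + mvar None * g" by simp
    have f0I: "f0 \<in> ?I"
      unfolding f0_def using W step(1) deg
      by (intro ideal_sum[OF I] high_monomial_mem_hom_of_Ann) (auto simp: K0_def)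
    have f0J: "f0 \<in> J"
      unfolding f0_def
    proof (rule ideal_sum[OF J])
      fix u assume u: "u \<in> K0"
      then have u0: "coef u None = 0" and du: "mdeg u = Suc e" using deg by (auto simp: K0_def)
      have "u \<noteq> 0" using du by auto
      then obtain i where i: "coef u i \<noteq> 0" by (metis lookup_zero poly_mapping_eqI)
      \<comment> \<open>Dividing by one variable leaves degree \<open>e\<close>, which still exceeds
        \<open>d1\<close>; this is why the induction starts at \<open>Suc d1\<close>.\<close>
      let ?v = "u - Poly_Mapping.single i 1"
      have uv: "u = Poly_Mapping.single i 1 + ?v" using expo_split[OF i] .
      have dv: "mdeg ?v = e" using du arg_cong[OF uv, of mdeg] by simp
      have "coef ?v None = 0" using u0 by (simp add: lookup_minus)
      then have "Poly_Mapping.single ?v (coef f u) \<in> ?I"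
        using W step(1) dv by (intro high_monomial_mem_hom_of_Ann) auto
      moreover have "Poly_Mapping.single ?v (coef f u) \<in> homog_part e"
        using dv by (auto simp: homog_part_def)
      ultimately have "Poly_Mapping.single ?v (coef f u) \<in> J" using step.IH by blast
      then have "mvar i * Poly_Mapping.single ?v (coef f u) \<in> J" using J by (simp add: is_ideal_iff)
      then show "Poly_Mapping.single u (coef f u) \<in> J"
        using uv by (simp add: mvar_def mult_single)
    qed
    have gh: "g \<in> homog_part e"
      unfolding g_def
    proof (rule pm.subspace_sum[OF subspace_homog_part])
      fix u assume "u \<in> K1"
      then have "mdeg u = Suc e" "coef u None \<noteq> 0" using deg by (auto simp: K1_def)
      then have "mdeg (u - Poly_Mapping.single None 1) = e"
        using arg_cong[OF expo_split[of u None], of mdeg] by simp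
      then show "Poly_Mapping.single (u - Poly_Mapping.single None 1) (coef f u) \<in> homog_part e"
        by (auto simp: homog_part_def)
    qed
    have "mvar None * g \<in> homog_part (mdeg (Poly_Mapping.single (None :: 'n option) (1::nat)) + e)"
      unfolding mvar_def by (rule homog_part_single_mult[OF gh])
    then have mh: "mvar None * g \<in> homog_part (Suc e)" by simp
    have "mvar None * g \<in> ?I" using split f f0I ideal_diff[OF I, of f f0] by simp
    then have "dehomogenize (mvar None * g) \<in> Ann W"
      using homog_mem_hom_of_iff[OF is_ideal_Ann mh] by blast
    then have "dehomogenize g \<in> Ann W" by (simp add: dehomogenize_mult mvar_def)
    then have "g \<in> J" using step.IH gh homog_mem_hom_of_iff[OF is_ideal_Ann gh] by blast
    then show "f \<in> J" using split f0J J by (simp add: is_ideal_iff)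
  qed
qed

section \<open>Ideals agreeing with the homogenized one in high degrees\<close>

text \<open>An upper bound, in terms of monomials, for the \<open>N\<close>-th power of the
  irrelevant ideal.\<close>

definition order_ge :: "nat \<Rightarrow> ('i, 'k::comm_ring_1) mpoly set" where
  "order_ge N = {g. \<forall>u. coef g u \<noteq> 0 \<longrightarrow> N \<le> mdeg u}"

lemma order_ge_single_mult:
  assumes "g \<in> order_ge N"
  shows "Poly_Mapping.single u c * g \<in> order_ge (mdeg u + N)"
  unfolding order_ge_def
proof (intro CollectI allI impI)
  fix v assume nz: "coef (Poly_Mapping.single u c * g) v \<noteq> 0"
  then have "\<exists>w. v = u + w" using coef_single_mult(2)[of v u c g] by blast
  then obtain w where w: "v = u + w" by blast
  then have "coef g w \<noteq> 0" using nz coef_single_mult(1)[of u c g w] by auto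
  then show "mdeg u + N \<le> mdeg v" using assms w by (simp add: order_ge_def)
qed

lemma order_ge_add: "f \<in> order_ge N \<Longrightarrow> g \<in> order_ge N \<Longrightarrow> f + g \<in> order_ge N"
proof -
  assume a: "f \<in> order_ge N" "g \<in> order_ge N"
  have "N \<le> mdeg u" if "coef (f + g) u \<noteq> 0" for u
  proof -
    have "coef f u \<noteq> 0 \<or> coef g u \<noteq> 0" using that by (auto simp: lookup_add)
    then show ?thesis using a by (auto simp: order_ge_def)
  qed
  then show ?thesis by (simp add: order_ge_def)
qed

lemma order_ge_mono: "M \<le> N \<Longrightarrow> order_ge N \<subseteq> order_ge M"
  unfolding order_ge_def by (auto intro: order_trans)

lemma is_ideal_order_ge: "is_ideal (order_ge N :: ('i, 'k::comm_ring_1) mpoly set)"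
proof (rule is_idealI)
  show "f + g \<in> order_ge N" if "f \<in> order_ge N" "g \<in> order_ge N" for f g :: "('i, 'k) mpoly"
    using that by (rule order_ge_add)
  show "(0 :: ('i, 'k) mpoly) \<in> order_ge N" by (simp add: order_ge_def)
  fix u c and f :: "('i, 'k) mpoly" assume "f \<in> order_ge N"
  then show "Poly_Mapping.single u c * f \<in> order_ge N"
    using order_ge_single_mult[of f N u c] order_ge_mono[of N "mdeg u + N"] by auto
qed

lemma order_ge_mult:
  assumes "f \<in> order_ge M" "g \<in> order_ge N"
  shows "f * g \<in> order_ge (M + N)"
proof -
  have "(\<Sum>u\<in>Poly_Mapping.keys f. Poly_Mapping.single u (coef f u) * g) \<in> order_ge (M + N)"
  proof (rule ideal_sum[OF is_ideal_order_ge])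
    fix u assume "u \<in> Poly_Mapping.keys f"
    then have "M \<le> mdeg u" using assms(1) by (simp add: order_ge_def in_keys_iff)
    then show "Poly_Mapping.single u (coef f u) * g \<in> order_ge (M + N)"
      using order_ge_single_mult[OF assms(2), of u "coef f u"] order_ge_mono[of "M + N" "mdeg u + N"] by auto
  qed
  moreover have "f * g = (\<Sum>u\<in>Poly_Mapping.keys f. Poly_Mapping.single u (coef f u)) * g"
    by (rule arg_cong[OF poly_mapping_sum_singles])
  ultimately show ?thesis by (simp add: sum_distrib_right)
qed

lemma ideal_power_irrelevant_subset:
  "ideal_power (irrelevant_ideal :: ('i, 'k::comm_ring_1) mpoly set) N \<subseteq> order_ge N"
proof (induction N)
  case (Suc N)
  have "irrelevant_ideal \<subseteq> (order_ge 1 :: ('i, 'k) mpoly set)"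
    unfolding irrelevant_ideal_def
    by (rule ideal_gen_minimal[OF _ is_ideal_order_ge])
      (auto simp: order_ge_def mvar_def lookup_single when_def split: if_splits)
  then have "{f * g | f g. f \<in> irrelevant_ideal \<and> g \<in> ideal_power irrelevant_ideal N}
      \<subseteq> (order_ge (1 + N) :: ('i, 'k) mpoly set)"
    using Suc order_ge_mult by blast
  then show ?case by (simp add: ideal_gen_minimal[OF _ is_ideal_order_ge])
qed (simp add: order_ge_def)

text \<open>Multiplying by the \<open>N\<close>-th power of the irrelevant ideal leaves only
  components of degree at least \<open>N\<close>, where the ideals agree. Conversely,
  \<open>hom_of A\<close> allows cancelling powers of \<open>\<alpha>\<^sub>0\<close>.\<close>

lemma saturation_eq_hom_of:
  fixes J :: "('n::finite option, 'k::field) mpoly set"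
  assumes A: "is_ideal A" and J: "homogeneous_ideal J"
    and eq: "\<And>e. N \<le> e \<Longrightarrow> J \<inter> homog_part e = hom_of A \<inter> homog_part e"
  shows "saturation J = hom_of A"
proof
  have iJ: "is_ideal J" and hJ: "\<And>f e. f \<in> J \<Longrightarrow> hcomp e f \<in> J"
    using J unfolding homogeneous_ideal_def by auto
  have I: "is_ideal (hom_of A)" by (rule is_ideal_hom_of[OF A])
  show "saturation J \<subseteq> hom_of A"
  proof
    fix f assume "f \<in> saturation J"
    then obtain M where "\<forall>g\<in>ideal_power irrelevant_ideal M. f * g \<in> J"
      unfolding saturation_def by blast
    then have "f * Poly_Mapping.single (Poly_Mapping.single None M) 1 \<in> J"
      by (rule bspec) (rule var_power_mem_ideal_power)
    \<comment> \<open>The additional power \<open>N\<close> moves every component of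
      \<open>f\<close> to a degree where \<open>eq\<close> applies.\<close>
    then have "Poly_Mapping.single (Poly_Mapping.single None N) 1 *
        (f * Poly_Mapping.single (Poly_Mapping.single None M) 1) \<in> J"
      using iJ by (simp add: is_ideal_iff)
    also have "Poly_Mapping.single (Poly_Mapping.single None N) 1 *
        (f * Poly_Mapping.single (Poly_Mapping.single None M) 1)
        = Poly_Mapping.single (Poly_Mapping.single None (M + N)) 1 * f"
      by (simp add: mult.left_commute mult_single single_add mult.commute add.commute)
    finally have m: "Poly_Mapping.single (Poly_Mapping.single None (M + N)) 1 * f \<in> J" .
    show "f \<in> hom_of A"
    proof (rule mem_hom_of_if_shift_mem[OF A, of "M + N"])
      fix e
      let ?h = "hcomp (e + (M + N)) (Poly_Mapping.single (Poly_Mapping.single None (M + N)) 1 * f)"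
      have "?h \<in> J \<inter> homog_part (e + (M + N))" using hJ[OF m] hcomp_in_homog_part by blast
      then have "?h \<in> hom_of A" using eq[of "e + (M + N)"] by auto
      then show "dehomogenize ?h \<in> A" using homog_mem_hom_of_iff[OF A hcomp_in_homog_part] by blast
    qed
  qed
  show "hom_of A \<subseteq> saturation J"
  proof
    fix f assume f: "f \<in> hom_of A"
    have "f * g \<in> J" if g: "g \<in> ideal_power irrelevant_ideal N" for g
    proof (rule ideal_mem_if_hcomp_mem[OF iJ])
      fix e
      have fg: "f * g \<in> hom_of A" using ideal_mult_right[OF I f] .
      have o: "f * g \<in> order_ge N"
        using g ideal_power_irrelevant_subset[of N] is_ideal_order_ge[of N] unfolding is_ideal_iff by blast
      show "hcomp e (f * g) \<in> J"
      proof (cases "N \<le> e")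
        case True
        have "hcomp e (f * g) \<in> hom_of A"
          using fg homogeneous_ideal_hom_of[OF A] unfolding homogeneous_ideal_def by blast
        then show ?thesis using eq[OF True] hcomp_in_homog_part[of e "f * g"] by blast
      next
        case False
        then have "hcomp e (f * g) = 0"
          using o by (intro poly_mapping_eqI) (auto simp: coef_hcomp order_ge_def)
        then show ?thesis using iJ by (simp add: is_ideal_iff)
      qed
    qed
    then show "f \<in> saturation J" unfolding saturation_def by blast
  qed
qed

section \<open>Spans of Veronese images\<close>

lemma coef_veronese_pullback:
  "coef (veronese_pullback d \<phi>) u = (if mdeg u = d then \<phi> (Poly_Mapping.single u 1) else 0)"
proof -
  have "coef (veronese_pullback d \<phi>) u
      = (\<Sum>v\<in>{v. mdeg v = d}. if v = u then \<phi> (Poly_Mapping.single u 1) else 0)"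
    unfolding veronese_pullback_def lookup_sum by (rule sum.cong) (auto simp: lookup_single when_def)
  then show ?thesis by (simp add: finite_mdeg_eq)
qed

lemma veronese_pullback_in_homog_part: "veronese_pullback d \<phi> \<in> homog_part d"
  by (simp add: homog_part_iff coef_veronese_pullback)

lemma linear_eq_sum_singles:
  fixes \<phi> :: "('a \<Rightarrow>\<^sub>0 'k::field) \<Rightarrow> 'k"
  assumes "Vector_Spaces.linear pscale (*) \<phi>"
  shows "\<phi> F = (\<Sum>u\<in>Poly_Mapping.keys F. coef F u * \<phi> (Poly_Mapping.single u 1))"
proof -
  interpret L: Vector_Spaces.linear pscale "(*)" \<phi> by fact
  have "\<phi> F = \<phi> (\<Sum>u\<in>Poly_Mapping.keys F. pscale (coef F u) (Poly_Mapping.single u 1))"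
    unfolding pscale_single mult_1_right using poly_mapping_sum_singles[of F] by (rule arg_cong)
  also have "\<dots> = (\<Sum>u\<in>Poly_Mapping.keys F. coef F u * \<phi> (Poly_Mapping.single u 1))"
    by (simp add: L.sum L.scale)
  finally show ?thesis .
qed

text \<open>The constant coefficient of a contraction is the pairing that makes the monomial bases
  dual. It is symmetric because polynomials and divided powers share one representation.\<close>

lemma coef_contract_0_commute: "coef (\<theta> \<lrcorner> F) 0 = coef (F \<lrcorner> \<theta>) 0"
  using coef_contract_superset[of "Poly_Mapping.keys \<theta> \<union> Poly_Mapping.keys F" \<theta> F 0]
    coef_contract_superset[of "Poly_Mapping.keys \<theta> \<union> Poly_Mapping.keys F" F \<theta> 0]
  by (simp add: mult.commute)

text \<open>The pullback is the polynomial that represents \<open>\<phi>\<close> on degree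
  \<open>d\<close> under this pairing.\<close>

lemma veronese_pullback_pairing:
  assumes "Vector_Spaces.linear pscale (*) \<phi>" "F \<in> homog_part d"
  shows "coef (veronese_pullback d \<phi> \<lrcorner> F) 0 = \<phi> F"
proof -
  have "coef (veronese_pullback d \<phi> \<lrcorner> F) 0 = coef (F \<lrcorner> veronese_pullback d \<phi>) 0"
    by (rule coef_contract_0_commute)
  also have "\<dots> = (\<Sum>u\<in>Poly_Mapping.keys F. coef F u * \<phi> (Poly_Mapping.single u 1))"
    unfolding coef_contract
    by (rule sum.cong) (use assms(2) in \<open>auto simp: coef_veronese_pullback homog_part_def\<close>)
  also have "\<dots> = \<phi> F" by (rule linear_eq_sum_singles[OF assms(1), symmetric])
  finally show ?thesis .
qed

text \<open>One half of the apolarity lemma: a functional separating \<open>F\<close> from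
  \<open>E\<close> would pull back to an element of \<open>I\<close> that does not annihilate
  \<open>F\<close>.\<close>

lemma subset_veronese_span:
  assumes V: "V \<subseteq> homog_part d" and I: "I \<subseteq> Ann V"
  shows "V \<subseteq> veronese_span d I"
  unfolding veronese_span_def
proof (intro subsetI InterI, elim CollectE conjE)
  fix F E assume F: "F \<in> V" and E: "pm.subspace E" "veronese_image_in d I E"
  show "F \<in> E"
  proof (rule ccontr)
    assume "F \<notin> E"
    then obtain \<phi> where \<phi>: "Vector_Spaces.linear pscale (*) \<phi>" "\<And>G. G \<in> E \<Longrightarrow> \<phi> G = 0" "\<phi> F = 1"
      using separating_functional[OF E(1)] by metis
    then have "veronese_pullback d \<phi> \<in> I" using E(2) unfolding veronese_image_in_def by blast
    then have "veronese_pullback d \<phi> \<lrcorner> F = 0" using I F by (auto simp: Ann_def)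
    then show False using veronese_pullback_pairing[OF \<phi>(1), of F d] F V \<phi>(3) by auto
  qed
qed

text \<open>The other half of the apolarity lemma: the orthogonal complement of the degree
  \<open>d\<close> part of \<open>I\<close> contains the Veronese span. Annihilation in degree
  \<open>e\<close> is reduced to the pairing in degree \<open>d\<close> by multiplying with
  monomials.\<close>

lemma ideal_subset_Ann_if_subset_veronese_span:
  fixes I :: "('i::finite, 'k::field) mpoly set"
  assumes I: "is_ideal I" and V: "V \<subseteq> homog_part d" "V \<subseteq> veronese_span d I"
  shows "I \<inter> homog_part e \<subseteq> Ann V"
proof -
  \<comment> \<open>This orthogonal complement is shown to be one of the subspaces in the
    intersection \<open>veronese_span d I\<close>.\<close>
  define E where "E = {F \<in> homog_part d. \<forall>\<theta>\<in>I \<inter> homog_part d. coef (\<theta> \<lrcorner> F) 0 = 0}"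
  have sE: "pm.subspace E"
    using subspace_homog_part[of d] unfolding pm.subspace_def E_def
    by (auto simp: contract_add_right contract_pscale_right lookup_add lookup_pscale)
  have sI: "pm.subspace (I \<inter> homog_part d)"
    using ideal_subspace[OF I] subspace_homog_part by (rule pm.subspace_inter)
  have "veronese_image_in d I E"
    unfolding veronese_image_in_def
  proof (intro allI impI, elim conjE)
    fix \<phi> :: "('i, 'k) dpoly \<Rightarrow> 'k"
    assume \<phi>: "Vector_Spaces.linear pscale (*) \<phi>" "\<forall>F\<in>E. \<phi> F = 0"
    show "veronese_pullback d \<phi> \<in> I"
    proof (rule ccontr)
      assume "veronese_pullback d \<phi> \<notin> I"
      then have "veronese_pullback d \<phi> \<notin> I \<inter> homog_part d" by blast
      \<comment> \<open>Biduality: the pullback of \<open>\<psi>\<close> is an element of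
        \<open>E\<close> at which \<open>\<phi>\<close> takes the value \<open>1\<close>.\<close>
      then obtain \<psi> where \<psi>: "Vector_Spaces.linear pscale (*) \<psi>"
        "\<And>G. G \<in> I \<inter> homog_part d \<Longrightarrow> \<psi> G = 0" "\<psi> (veronese_pullback d \<phi>) = 1"
        using separating_functional[OF sI] by metis
      have *: "coef (\<theta> \<lrcorner> veronese_pullback d \<psi>) 0 = \<psi> \<theta>" if "\<theta> \<in> homog_part d" for \<theta>
        using veronese_pullback_pairing[OF \<psi>(1) that] coef_contract_0_commute by metis
      have "veronese_pullback d \<psi> \<in> E"
        unfolding E_def using * \<psi>(2) veronese_pullback_in_homog_part by auto
      then have "\<phi> (veronese_pullback d \<psi>) = 0" using \<phi>(2) by blast
      moreover have "\<phi> (veronese_pullback d \<psi>) = 1"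
        using veronese_pullback_pairing[OF \<phi>(1) veronese_pullback_in_homog_part[of d \<psi>]]
          *[OF veronese_pullback_in_homog_part[of d \<phi>]] \<psi>(3) by simp
      ultimately show False by simp
    qed
  qed
  then have "veronese_span d I \<subseteq> E" unfolding veronese_span_def using sE by (auto simp: E_def)
  then have VE: "V \<subseteq> E" using V(2) by blast
  show ?thesis
  proof
    fix \<theta> assume \<theta>: "\<theta> \<in> I \<inter> homog_part e"
    have "\<theta> \<lrcorner> F = 0" if F: "F \<in> V" for F
    proof (rule poly_mapping_eqI, rule ccontr)
      fix w assume "coef (\<theta> \<lrcorner> F) w \<noteq> coef 0 w"
      then have nz: "coef (\<theta> \<lrcorner> F) w \<noteq> 0" by simp
      then have "e + mdeg w = d" using coef_contract_homog \<theta> F V(1) by blast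
      \<comment> \<open>The coefficient of \<open>\<theta> \<lrcorner> F\<close> at \<open>w\<close>
        is the pairing of \<open>F\<close> with the monomial \<open>w\<close> times
        \<open>\<theta>\<close>.\<close>
      then have "Poly_Mapping.single w 1 * \<theta> \<in> homog_part d"
        using homog_part_single_mult[of \<theta> e w 1] \<theta> by (simp add: add.commute)
      moreover have "Poly_Mapping.single w 1 * \<theta> \<in> I" using \<theta> I by (simp add: is_ideal_iff)
      ultimately have "coef ((Poly_Mapping.single w 1 * \<theta>) \<lrcorner> F) 0 = 0" using VE F by (auto simp: E_def)
      then show False using nz by (simp add: contract_mult coef_contract_single)
    qed
    then show "\<theta> \<in> Ann V" by (simp add: Ann_def)
  qed
qed

section \<open>Hilbert functions of saturated ideals\<close>

text \<open>The polynomials that multiply \<open>f\<close> into \<open>I\<close> form an ideal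
  containing all variables, so the exponent \<open>1\<close> serves in the definition of
  \<open>saturation\<close>.\<close>

lemma saturated_mem_if_var_mult_mem:
  fixes I :: "('i, 'k::comm_ring_1) mpoly set"
  assumes I: "is_ideal I" "saturation I = I" and f: "\<And>i. mvar i * f \<in> I"
  shows "f \<in> I"
proof -
  let ?K = "{g. f * g \<in> I}"
  have K: "is_ideal ?K"
    using I(1) unfolding is_ideal_iff by (auto simp: distrib_left mult.left_commute)
  have "irrelevant_ideal \<subseteq> ?K"
    unfolding irrelevant_ideal_def by (rule ideal_gen_minimal[OF _ K]) (use f in \<open>auto simp: mult.commute\<close>)
  then have "{a * b | a b. a \<in> irrelevant_ideal \<and> b \<in> ideal_power irrelevant_ideal 0} \<subseteq> ?K"
    using ideal_mult_right[OF K] by blast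
  then have "ideal_power irrelevant_ideal (Suc 0) \<subseteq> ?K"
    unfolding ideal_power.simps(2) by (rule ideal_gen_minimal[OF _ K])
  then have "f \<in> saturation I" unfolding saturation_def by blast
  then show ?thesis using I(2) by simp
qed

text \<open>McCoy's argument for \<open>(\<Sum>\<^sub>j x\<^sub>j t\<^sup>j) (\<Sum>\<^sub>p F\<^sub>p t\<^sup>p) \<in> I[t]\<close>: the topmost \<open>x\<^sub>i\<close> not yet known to
  kill \<open>F\<close> modulo \<open>I\<close> kills its leading coefficient, so \<open>x\<^sub>i F\<close> has smaller degree in \<open>t\<close>.\<close>

lemma mccoy:
  fixes x F :: "nat \<Rightarrow> 'a::comm_ring_1"
  assumes I: "is_ideal I" and sat: "\<And>f. (\<And>j. j \<le> n \<Longrightarrow> x j * f \<in> I) \<Longrightarrow> f \<in> I"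
    and "\<And>q. (\<Sum>j\<le>n. x j * (if j \<le> q then F (q - j) else 0)) \<in> I" and "\<And>p. m \<le> p \<Longrightarrow> F p \<in> I"
  shows "F p \<in> I"
  using assms(3,4)
proof (induction m arbitrary: F p)
  case (Suc m)
  note IHm = Suc.IH and FI = Suc.prems(1) and F_high = Suc.prems(2)
  have I_mult: "c * f \<in> I" if "f \<in> I" for c f using I that by (simp add: is_ideal_iff)
  have I0: "0 \<in> I" using I by (simp add: is_ideal_iff)
  \<comment> \<open>Descending induction on the index: after \<open>t\<close> rounds the last
    \<open>t\<close> of the elements \<open>x i\<close> multiply all coefficients into
    \<open>I\<close>.\<close>
  have "\<forall>i\<le>n. n < i + t \<longrightarrow> (\<forall>p. x i * F p \<in> I)" for t
  proof (induction t)
    case (Suc t)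
    have "x i * F p \<in> I" if i: "i \<le> n" "n < i + Suc t" for i p
    proof (cases "n < i + t")
      case False
      \<comment> \<open>In the coefficient at \<open>i + m\<close>, the terms with
        \<open>j < i\<close> involve coefficients beyond \<open>m\<close>, and those with
        \<open>j > i\<close> are settled by earlier rounds. Only \<open>x i * F m\<close>
        remains.\<close>
      let ?t = "\<lambda>j. x j * (if j \<le> i + m then F (i + m - j) else 0)"
      have others: "?t j \<in> I" if j: "j \<in> {..n} - {i}" for j
      proof (cases "j < i")
        case True
        then have "F (i + m - j) \<in> I" by (intro F_high) simp
        then show ?thesis using I_mult I0 by simp
      next
        case False
        then have "n < j + t" "j \<le> n" using j i \<open>\<not> n < i + t\<close> by auto
        then show ?thesis using Suc.IH I0 by simp
      qed
      have "(\<Sum>j\<le>n. ?t j) - (\<Sum>j\<in>{..n} - {i}. ?t j) \<in> I"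
        using ideal_diff[OF I FI ideal_sum[OF I others]] .
      also have "(\<Sum>j\<le>n. ?t j) - (\<Sum>j\<in>{..n} - {i}. ?t j) = ?t i"
        using i(1) by (subst sum.remove[of _ i]) auto
      finally have xm: "x i * F m \<in> I" by simp
      show "x i * F p \<in> I"
      proof (rule IHm)
        fix q
        have "(\<Sum>j\<le>n. x j * (if j \<le> q then x i * F (q - j) else 0))
            = x i * (\<Sum>j\<le>n. x j * (if j \<le> q then F (q - j) else 0))"
          unfolding sum_distrib_left by (rule sum.cong) (auto simp: mult.left_commute)
        then show "(\<Sum>j\<le>n. x j * (if j \<le> q then x i * F (q - j) else 0)) \<in> I"
          using FI I_mult by simp
      next
        fix p assume "m \<le> p"
        then show "x i * F p \<in> I" using xm F_high I_mult by (cases "p = m") auto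
      qed
    qed (use Suc.IH i in blast)
    then show ?case by blast
  qed simp
  from this[of "Suc n"] have "x j * F p \<in> I" if "j \<le> n" for j using that by simp
  then show ?case by (rule sat)
qed simp

lemma sum_shift_delta:
  "(\<Sum>p<m. if p + j = (q::nat) then g p else (0::'a::comm_monoid_add)) = (if j \<le> q \<and> q - j < m then g (q - j) else 0)"
proof (cases "j \<le> q")
  case True
  then have "(\<Sum>p<m. if p + j = q then g p else 0) = (\<Sum>p<m. if p = q - j then g p else 0)"
    by (intro sum.cong) auto
  then show ?thesis using True by auto
qed simp

text \<open>With \<open>h\<close>, \<open>h'\<close> the values of the Hilbert function at \<open>e\<close>, \<open>e + 1\<close> and \<open>n + 1\<close> variables, the
  multiplication by \<open>\<Sum>\<^sub>j \<alpha>\<^sub>j t\<^sup>j\<close> embeds polynomials in \<open>t\<close> of degree \<open>< m\<close> over the \<open>e\<close>-th part into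
  those of degree \<open>< m + n\<close> over the next one, so \<open>m h \<le> (m + n) h'\<close> for all \<open>m\<close>, which forces
  \<open>h \<le> h'\<close>.  Thus no linear nonzerodivisor is needed.\<close>

lemma hilbert_fun_saturated_mono:
  fixes I :: "('i::finite, 'k::field) mpoly set"
  assumes I: "is_ideal I" "saturation I = I"
  shows "hilbert_fun I e \<le> hilbert_fun I (Suc e)"
proof (rule ccontr)
  assume less: "\<not> ?thesis"
  have sI: "pm.subspace I" by (rule ideal_subspace[OF I(1)])
  obtain C where C: "quotient_basis (homog_part e) (I \<inter> homog_part e) C" "finite C" "hilbert_fun I e = card C"
    unfolding hilbert_fun_def by (rule fin_quotient_basis[OF fin_quotient_homog_part[OF sI]])
  obtain C' where C': "quotient_basis (homog_part (Suc e)) (I \<inter> homog_part (Suc e)) C'" "finite C'"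
      "hilbert_fun I (Suc e) = card C'"
    unfolding hilbert_fun_def by (rule fin_quotient_basis[OF fin_quotient_homog_part[OF sI]])
  obtain v where v: "bij_betw v {0..<card (UNIV :: 'i set)} (UNIV :: 'i set)"
    using ex_bij_betw_nat_finite[of "UNIV :: 'i set"] by auto
  define n where "n = card (UNIV :: 'i set) - 1"
  define x where "x j = (mvar (v j) :: ('i, 'k) mpoly)" for j
  have n: "j \<le> n \<longleftrightarrow> j < card (UNIV :: 'i set)" for j
  proof -
    have "card (UNIV :: 'i set) > 0" by (simp add: finite_UNIV_card_ge_0)
    then show ?thesis unfolding n_def by linarith
  qed
  \<comment> \<open>Chosen so that \<open>m > n * card C'\<close>, which makes
    \<open>(m + n) * card C' < m * Suc (card C')\<close>.\<close>
  define m where "m = Suc (n * card C')"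
  have ex: "\<exists>q. x j * c - (\<Sum>c'\<in>C'. pscale (q c') c') \<in> I" if c: "c \<in> C" for j c
  proof -
    have "c \<in> homog_part e" using C(1) c by (auto simp: quotient_basis_def)
    then have "x j * c \<in> homog_part (mdeg (Poly_Mapping.single (v j) (1::nat)) + e)"
      unfolding x_def mvar_def by (rule homog_part_single_mult)
    then have "x j * c \<in> homog_part (Suc e)" by simp
    then obtain q where "x j * c - (\<Sum>c'\<in>C'. pscale (q c') c') \<in> I \<inter> homog_part (Suc e)"
      by (rule quotient_basis_coordinates[OF C'(1,2)])
    then show ?thesis by blast
  qed
  define q where "q j c = (SOME q. x j * c - (\<Sum>c'\<in>C'. pscale (q c') c') \<in> I)" for j c
  have q: "x j * c - (\<Sum>c'\<in>C'. pscale (q j c c') c') \<in> I" if "c \<in> C" for j c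
    unfolding q_def by (rule someI_ex[OF ex[OF that]])
  let ?X = "{..<m} \<times> C" and ?Y = "{..<m + n} \<times> C'"
  \<comment> \<open>The matrix, modulo \<open>I\<close>, of multiplication by the linear form in
    \<open>t\<close>: the index \<open>(p, c)\<close> stands for \<open>c\<close> times the
    \<open>p\<close>-th power of \<open>t\<close>, and \<open>(k, c')\<close> for a coordinate of
    the product.\<close>
  define M where "M pc y = (case pc of (p, c) \<Rightarrow> case y of (k, c') \<Rightarrow>
      if p \<le> k \<and> k - p \<le> n then q (k - p) c c' else 0)" for pc y
  have "card ?Y < card ?X"
  proof -
    have "(m + n) * card C' < m * Suc (card C')" by (simp add: m_def algebra_simps)
    also have "\<dots> \<le> m * card C" using less C(3) C'(3) by (intro mult_le_mono) auto
    finally show ?thesis by (simp add: card_cartesian_product)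
  qed
  then obtain a where a: "\<exists>z\<in>?X. a z \<noteq> 0" "\<And>y. y \<in> ?Y \<Longrightarrow> (\<Sum>z\<in>?X. a z * M z y) = 0"
    using homogeneous_system_nontrivial_solution[of ?Y ?X M] C(2) C'(2) by auto
  \<comment> \<open>The coefficients of the polynomial in \<open>t\<close> given by the kernel
    vector \<open>a\<close>; \<open>mccoy\<close> puts them into \<open>I\<close>.\<close>
  define F where "F p = (if p < m then \<Sum>c\<in>C. pscale (a (p, c)) c else 0)" for p
  have scale_mult: "f * pscale b g = pscale b (f * g)" for b and f g :: "('i, 'k) mpoly"
    by (simp add: pscale_eq_mult mult.left_commute)
  have FI: "F p \<in> I" for p
  proof (rule mccoy[OF I(1)])
    fix f assume f: "\<And>j. j \<le> n \<Longrightarrow> x j * f \<in> I"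
    show "f \<in> I"
    proof (rule saturated_mem_if_var_mult_mem[OF I])
      fix i
      obtain j where "j < card (UNIV :: 'i set)" "v j = i" using v unfolding bij_betw_def by (metis UNIV_I atLeastLessThan_iff imageE)
      then show "mvar i * f \<in> I" using f[of j] n x_def by auto
    qed
  next
    fix p assume "m \<le> p"
    then show "F p \<in> I" using I(1) by (simp add: F_def is_ideal_iff)
  next
    fix k
    let ?T = "\<lambda>p j. \<Sum>c\<in>C. pscale (a (p, c)) (x j * c)"
    have "(\<Sum>j\<le>n. x j * (if j \<le> k then F (k - j) else 0))
        = (\<Sum>j\<le>n. \<Sum>p<m. if p + j = k then ?T p j else 0)"
      by (rule sum.cong) (auto simp: sum_shift_delta F_def sum_distrib_left scale_mult)
    also have "\<dots> = (\<Sum>p<m. \<Sum>j<Suc n. if j + p = k then ?T p j else 0)"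
      by (subst sum.swap) (simp add: lessThan_Suc_atMost add.commute)
    also have "\<dots> = (\<Sum>p<m. if p \<le> k \<and> k - p \<le> n then ?T p (k - p) else 0)"
      unfolding sum_shift_delta by (simp add: less_Suc_eq_le)
    also have "\<dots> = (\<Sum>p<m. \<Sum>c\<in>C. pscale (a (p, c)) (if p \<le> k \<and> k - p \<le> n then x (k - p) * c else 0))"
      by (rule sum.cong) auto
    also have "\<dots> = (\<Sum>z\<in>?X. pscale (a z) (case z of (p, c) \<Rightarrow> if p \<le> k \<and> k - p \<le> n then x (k - p) * c else 0))"
      by (simp add: sum.cartesian_product case_prod_unfold)
    finally have S: "(\<Sum>j\<le>n. x j * (if j \<le> k then F (k - j) else 0))
      = (\<Sum>z\<in>?X. pscale (a z) (case z of (p, c) \<Rightarrow> if p \<le> k \<and> k - p \<le> n then x (k - p) * c else 0))" .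
    show "(\<Sum>j\<le>n. x j * (if j \<le> k then F (k - j) else 0)) \<in> I"
    proof (cases "k < m + n")
      case True
      show ?thesis
        unfolding S
      proof (rule sum_mem_mod_quotient_basis[where C = C' and q = "\<lambda>z c'. M z (k, c')", OF _ _ sI])
        fix z assume "z \<in> ?X"
        then show "(case z of (p, c) \<Rightarrow> if p \<le> k \<and> k - p \<le> n then x (k - p) * c else 0)
            - (\<Sum>c'\<in>C'. pscale (M z (k, c')) c') \<in> I"
          using q I(1) by (auto simp: M_def is_ideal_iff)
      next
        fix c' assume "c' \<in> C'"
        then show "(\<Sum>z\<in>?X. a z * M z (k, c')) = 0" using a(2)[of "(k, c')"] True by simp
      qed
    next
      case False
      then have "(\<Sum>j\<le>n. x j * (if j \<le> k then F (k - j) else 0)) = 0"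
        by (intro sum.neutral) (auto simp: F_def)
      then show ?thesis using I(1) by (simp add: is_ideal_iff)
    qed
  qed
  \<comment> \<open>A nonzero entry of \<open>a\<close> yields a nontrivial combination of the
    quotient basis \<open>C\<close> that lies in \<open>I\<close>.\<close>
  obtain p c where pc: "p < m" "c \<in> C" "a (p, c) \<noteq> 0" using a(1) by auto
  have Fp: "F p = (\<Sum>c\<in>C. pscale (a (p, c)) c)" using pc by (simp add: F_def)
  have sp: "F p \<in> pm.span C" unfolding Fp by (intro pm.span_sum pm.span_scale pm.span_base)
  have "pm.span C \<subseteq> homog_part e"
    using C(1) subspace_homog_part by (intro pm.span_minimal) (auto simp: quotient_basis_def)
  then have "F p = 0" using sp FI C(1) unfolding quotient_basis_def by blast
  moreover have "pm.independent C" using C(1) by (simp add: quotient_basis_def)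
  ultimately show False
    using pm.dependent_finite[OF C(2)] pc(2,3) unfolding Fp by (auto dest: spec[of _ "\<lambda>c. a (p, c)"])
qed

lemma hilbert_fun_le_length:
  assumes "zero_dim_scheme r I"
  shows "hilbert_fun I e \<le> r"
proof -
  have I: "is_ideal I" "saturation I = I" and ex: "\<exists>e0. \<forall>e\<ge>e0. hilbert_fun I e = r"
    using assms unfolding zero_dim_scheme_def homogeneous_ideal_def by auto
  obtain e0 where e0: "\<forall>e\<ge>e0. hilbert_fun I e = r" using ex by blast
  have "hilbert_fun I e \<le> hilbert_fun I (max e e0)"
    by (rule lift_Suc_mono_le[of "hilbert_fun I"]) (auto intro: hilbert_fun_saturated_mono[OF I])
  then show ?thesis using e0 by simp
qed

lemma hilbert_fun_Ann_le_cactus_rank: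
  fixes V :: "('i::finite, 'k::field) dpoly set"
  assumes V: "V \<subseteq> homog_part d" and r: "cactus_rank d V \<le> enat r"
  shows "hilbert_fun (Ann V) e \<le> r"
proof -
  \<comment> \<open>A nonempty set of extended naturals attains its infimum, while the empty set has
    infimum \<infinity>. Hence some scheme has length equal to the cactus rank.\<close>
  let ?S = "{enat r | r. 0 < r \<and> (\<exists>I. zero_dim_scheme r I \<and> V \<subseteq> veronese_span d I)}"
  have "?S \<noteq> {}"
  proof
    assume e: "?S = {}"
    have "cactus_rank d V = \<infinity>" unfolding cactus_rank_def e by (simp add: Inf_enat_def)
    then show False using r by simp
  qed
  then obtain y where "y \<in> ?S" by blast
  then have "(LEAST x. x \<in> ?S) \<in> ?S" by (rule LeastI)
  moreover have "cactus_rank d V = (LEAST x. x \<in> ?S)"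
    unfolding cactus_rank_def Inf_enat_def using \<open>?S \<noteq> {}\<close> by (rule if_not_P)
  ultimately have "cactus_rank d V \<in> ?S" by simp
  then obtain s I where s: "cactus_rank d V = enat s" "zero_dim_scheme s I" "V \<subseteq> veronese_span d I" by blast
  have I: "is_ideal I" using s(2) unfolding zero_dim_scheme_def homogeneous_ideal_def by blast
  have "hilbert_fun (Ann V) e \<le> hilbert_fun I e"
    by (rule hilbert_fun_antimono(1)[OF ideal_subspace[OF I] subspace_Ann
          ideal_subset_Ann_if_subset_veronese_span[OF I V s(3)]])
  also have "\<dots> \<le> s" by (rule hilbert_fun_le_length[OF s(2)])
  finally show ?thesis using r s(1) by simp
qed

section \<open>Catalecticant minors in Pluecker coordinates\<close>

lemma cofactor_cong_off_column:
  assumes "A \<in> carrier_mat n n" "B \<in> carrier_mat n n"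
    and "\<And>i' j'. i' < n \<Longrightarrow> j' < n \<Longrightarrow> j' \<noteq> j \<Longrightarrow> A $$ (i', j') = B $$ (i', j')"
  shows "cofactor A i j = cofactor B i j"
proof -
  have "mat_delete A i j = mat_delete B i j"
    by (rule eq_matI) (use assms in \<open>auto simp: mat_delete_def\<close>)
  then show ?thesis by (simp add: cofactor_def)
qed

text \<open>Induction on the number of functions: expanded along a new last column at
  \<open>v\<close>, the determinant is a combination of the values \<open>f l v\<close> in which
  \<open>f s v\<close> has the previous nonzero minor as coefficient. By independence it is nonzero
  for some \<open>v\<close> in \<open>D\<close>.\<close>

lemma nonzero_minor_exists:
  fixes f :: "nat \<Rightarrow> 'x \<Rightarrow> 'k::field"
  assumes "\<And>a. (\<And>x. x \<in> D \<Longrightarrow> (\<Sum>l<s. a l * f l x) = 0) \<Longrightarrow> \<forall>l<s. a l = 0"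
  shows "\<exists>cols. (\<forall>j<s. cols j \<in> D) \<and> det (mat s s (\<lambda>(l, j). f l (cols j))) \<noteq> 0"
  using assms
proof (induction s)
  case 0
  have "mat 0 0 (\<lambda>(l, j). f l (cols j)) \<in> carrier_mat 0 0" for cols by simp
  then show ?case by (metis det_dim_zero not_less_zero zero_neq_one)
next
  case (Suc s)
  have "\<exists>cols. (\<forall>j<s. cols j \<in> D) \<and> det (mat s s (\<lambda>(l, j). f l (cols j))) \<noteq> 0"
  proof (rule Suc.IH)
    fix a assume a: "\<And>x. x \<in> D \<Longrightarrow> (\<Sum>l<s. a l * f l x) = 0"
    have "(\<Sum>l<Suc s. (a(s := 0)) l * f l x) = 0" if "x \<in> D" for x
      using a[OF that] by simp
    from Suc.prems[OF this] show "\<forall>l<s. a l = 0" by (metis fun_upd_other less_Suc_eq less_irrefl)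
  qed
  then obtain cols where cols: "\<forall>j<s. cols j \<in> D" "det (mat s s (\<lambda>(l, j). f l (cols j))) \<noteq> 0" by blast
  define A where "A v = mat (Suc s) (Suc s) (\<lambda>(l, j). f l ((cols(s := v)) j))" for v
  \<comment> \<open>A placeholder for the last column: its cofactors are those of \<open>A v\<close>
    for every \<open>v\<close>.\<close>
  define B where "B = mat (Suc s) (Suc s) (\<lambda>(l, j). if j < s then f l (cols j) else 0)"
  have A: "A v \<in> carrier_mat (Suc s) (Suc s)" for v by (simp add: A_def)
  have B: "B \<in> carrier_mat (Suc s) (Suc s)" by (simp add: B_def)
  have "det (A v) = (\<Sum>l<Suc s. cofactor B l s * f l v)" for v
  proof -
    have "det (A v) = (\<Sum>l<Suc s. A v $$ (l, s) * cofactor (A v) l s)"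
      by (rule laplace_expansion_column[OF A]) simp
    also have "\<dots> = (\<Sum>l<Suc s. cofactor B l s * f l v)"
    proof (rule sum.cong[OF refl])
      fix l assume "l \<in> {..<Suc s}"
      moreover have "cofactor (A v) l s = cofactor B l s"
        by (rule cofactor_cong_off_column[OF A B]) (auto simp: A_def B_def)
      ultimately show "A v $$ (l, s) * cofactor (A v) l s = cofactor B l s * f l v" by (simp add: A_def)
    qed
    finally show ?thesis .
  qed
  moreover have "cofactor B s s \<noteq> 0"
  proof -
    have "mat_delete B s s = mat s s (\<lambda>(l, j). f l (cols j))"
      by (rule eq_matI) (auto simp: mat_delete_def B_def)
    then show ?thesis using cols(2) by (simp add: cofactor_def)
  qed
  ultimately obtain v where "v \<in> D" "det (A v) \<noteq> 0"
    using Suc.prems[of "\<lambda>l. cofactor B l s"] by (metis lessI)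
  then show ?case using cols(1) unfolding A_def
    by (intro exI[of _ "cols(s := v)"]) (auto simp: less_Suc_eq)
qed

definition minor_mat :: "('a \<Rightarrow>\<^sub>0 'k::field) list \<Rightarrow> 'a list \<Rightarrow> 'k mat" where
  "minor_mat b m = mat (length b) (length b) (\<lambda>(i, j). coef (b ! i) (m ! j))"

text \<open>Cramer's rule: the Pluecker coordinates \<open>p\<^bsub>m[i:=v]\<^esub>\<close> are the coefficients of vectors of the
  subspace, which span it if \<open>p\<^sub>m \<noteq> 0\<close>.\<close>

definition cramer_vec :: "('a \<Rightarrow>\<^sub>0 'k::field) list \<Rightarrow> 'a list \<Rightarrow> nat \<Rightarrow> ('a \<Rightarrow>\<^sub>0 'k)" where
  "cramer_vec b m i = (\<Sum>l<length b. pscale (cofactor (minor_mat b m) l i) (b ! l))"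

lemma coef_cramer_vec:
  assumes "length m = length b" "i < length b"
  shows "coef (cramer_vec b m i) v = pluecker b (m[i := v])"
proof -
  let ?A = "mat (length b) (length b) (\<lambda>(l, j). coef (b ! l) (m[i := v] ! j))"
  have "pluecker b (m[i := v]) = det ?A" using assms by (simp add: pluecker_def)
  also have "\<dots> = (\<Sum>l<length b. ?A $$ (l, i) * cofactor ?A l i)"
    by (rule laplace_expansion_column) (use assms in auto)
  also have "\<dots> = (\<Sum>l<length b. cofactor (minor_mat b m) l i * coef (b ! l) v)"
  proof (rule sum.cong[OF refl])
    fix l assume "l \<in> {..<length b}"
    moreover have "cofactor ?A l i = cofactor (minor_mat b m) l i"
      by (rule cofactor_cong_off_column[of _ "length b"]) (use assms in \<open>auto simp: minor_mat_def\<close>)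
    ultimately show "?A $$ (l, i) * cofactor ?A l i = cofactor (minor_mat b m) l i * coef (b ! l) v"
      using assms by simp
  qed
  finally show ?thesis by (simp add: cramer_vec_def lookup_sum lookup_pscale)
qed

lemma cramer_vec_in_span: "cramer_vec b m i \<in> pm.span (set b)"
  unfolding cramer_vec_def by (intro pm.span_sum pm.span_scale pm.span_base) auto

text \<open>The adjugate identity \<open>B * adj_mat B = det B\<close> for
  \<open>B = minor_mat b m\<close>, read off row \<open>c\<close>.\<close>

lemma det_scale_eq_sum_cramer_vec:
  assumes "c < length b"
  shows "pscale (det (minor_mat b m)) (b ! c) = (\<Sum>i<length b. pscale (coef (b ! c) (m ! i)) (cramer_vec b m i))"
proof -
  let ?B = "minor_mat b m" and ?k = "length b"
  have B: "?B \<in> carrier_mat ?k ?k" by (simp add: minor_mat_def)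
  have adj: "(\<Sum>i<?k. coef (b ! c) (m ! i) * cofactor ?B l i) = (if l = c then det ?B else 0)" if l: "l < ?k" for l
  proof -
    have "(?B * adj_mat ?B) $$ (c, l) = (\<Sum>i<?k. coef (b ! c) (m ! i) * cofactor ?B l i)"
      using l assms B unfolding times_mat_def scalar_prod_def adj_mat_def
      by (auto simp: minor_mat_def atLeast0LessThan intro!: sum.cong)
    moreover have "(?B * adj_mat ?B) $$ (c, l) = (if l = c then det ?B else 0)"
      unfolding adj_mat(2)[OF B] using l assms by auto
    ultimately show ?thesis by simp
  qed
  have "(\<Sum>i<?k. pscale (coef (b ! c) (m ! i)) (cramer_vec b m i))
      = (\<Sum>l<?k. pscale (\<Sum>i<?k. coef (b ! c) (m ! i) * cofactor ?B l i) (b ! l))"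
    unfolding cramer_vec_def pm.scale_sum_right pm.scale_sum_left
    by (subst sum.swap) simp
  also have "\<dots> = (\<Sum>l<?k. if l = c then pscale (det ?B) (b ! l) else 0)"
    by (rule sum.cong) (auto simp: adj)
  also have "\<dots> = pscale (det ?B) (b ! c)" using assms by simp
  finally show ?thesis by simp
qed

section \<open>Minors as homogeneous polynomials in Pluecker coordinates\<close>

lemma monom_val_superset:
  assumes "finite A" "Poly_Mapping.keys u \<subseteq> A"
  shows "monom_val a u = (\<Prod>i\<in>A. a i ^ coef u i)"
  unfolding monom_val_def
  by (rule prod.mono_neutral_left) (use assms in \<open>auto simp: in_keys_iff\<close>)

lemma monom_val_add: "monom_val a (u + v) = monom_val a u * monom_val a v"
proof -
  let ?A = "Poly_Mapping.keys u \<union> Poly_Mapping.keys v"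
  have "Poly_Mapping.keys (u + v) \<subseteq> ?A" by (rule Poly_Mapping.keys_add)
  then show ?thesis
    by (simp add: monom_val_superset[of ?A] lookup_add power_add prod.distrib)
qed

lemma mpoly_eval_mult: "mpoly_eval (p * q) a = mpoly_eval p a * mpoly_eval q a"
proof (induction p rule: poly_mapping_add_induct)
  case (single u c)
  show ?case
  proof (induction q rule: poly_mapping_add_induct)
    case (single v d)
    show ?case by (simp add: mult_single monom_val_add mult_ac)
  qed (simp add: distrib_left mpoly_eval_add)
qed (simp add: distrib_right mpoly_eval_add)

lemma mpoly_eval_one: "mpoly_eval 1 a = 1"
  using mpoly_eval_single[of 0 1 a] by (simp add: monom_val_def)

lemma mpoly_eval_det: "mpoly_eval (det M) a = det (map_mat (\<lambda>p. mpoly_eval p a) M)"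
proof -
  interpret comm_ring_hom "\<lambda>p. mpoly_eval p a"
    by unfold_locales (auto simp: mpoly_eval_add mpoly_eval_mult mpoly_eval_one)
  show ?thesis by simp
qed

lemma det_in_homog_part:
  fixes M :: "('i, 'k::field) mpoly mat"
  assumes M: "M \<in> carrier_mat s s" and h: "\<And>i j. i < s \<Longrightarrow> j < s \<Longrightarrow> M $$ (i, j) \<in> homog_part 1"
  shows "det M \<in> homog_part s"
  unfolding det_def'[OF M]
proof (rule pm.subspace_sum[OF subspace_homog_part])
  fix p assume p: "p \<in> {p. p permutes {0..<s}}"
  have "(\<Prod>i = 0..<t. M $$ (i, p i)) \<in> homog_part t" if "t \<le> s" for t
    using that
  proof (induction t)
    case 0
    show ?case by (simp add: homog_part_def)
  next
    case (Suc t)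
    then have "t < s" by simp
    then have "p t < s" using p permutes_in_image[of p "{0..<s}" t] by simp
    then have "(\<Prod>i = 0..<t. M $$ (i, p i)) * M $$ (t, p t) \<in> homog_part (t + 1)"
      using Suc \<open>t < s\<close> h by (intro homog_part_mult) auto
    then show ?case by simp
  qed
  then have h: "(\<Prod>i = 0..<s. M $$ (i, p i)) \<in> homog_part s" by simp
  show "signof p * (\<Prod>i = 0..<s. M $$ (i, p i)) \<in> homog_part s"
    using h pm.subspace_neg[OF subspace_homog_part h] by (simp add: sign_def)
qed

text \<open>The linear form in the Pluecker coordinates whose value is a coefficient of
  \<open>\<theta> \<lrcorner> cramer_vec b m i\<close>.\<close>

definition cat_entry :: "('i, 'k::field) mpoly \<Rightarrow> 'i expo list \<Rightarrow> nat \<times> 'i expo \<Rightarrow> ('i expo list, 'k) mpoly" where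
  "cat_entry \<theta> m y =
    (\<Sum>u\<in>Poly_Mapping.keys \<theta>. Poly_Mapping.single (Poly_Mapping.single (m[fst y := u + snd y]) 1) (coef \<theta> u))"

lemma cat_entry_in_homog_part: "cat_entry \<theta> m y \<in> homog_part 1"
  unfolding cat_entry_def by (rule pm.subspace_sum[OF subspace_homog_part]) (simp add: homog_part_def)

lemma mpoly_eval_cat_entry:
  assumes "length m = length b" "fst y < length b"
  shows "mpoly_eval (cat_entry \<theta> m y) (pluecker b) = coef (\<theta> \<lrcorner> cramer_vec b m (fst y)) (snd y)"
  unfolding cat_entry_def mpoly_eval_sum coef_contract
  by (rule sum.cong) (simp_all add: monom_val_def coef_cramer_vec[OF assms])

text \<open>A minor of the catalecticant map with rows \<open>\<theta> l\<close>; the column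
  \<open>y j\<close> names a Cramer vector and a coefficient of the contraction. Linear entries make
  it homogeneous of degree \<open>s\<close>, as \<open>Gr_closed\<close> demands.\<close>

definition cat_minor ::
    "nat \<Rightarrow> (nat \<Rightarrow> ('i, 'k::field) mpoly) \<Rightarrow> 'i expo list \<Rightarrow> (nat \<Rightarrow> nat \<times> 'i expo) \<Rightarrow> ('i expo list, 'k) mpoly" where
  "cat_minor s \<theta> m y = det (mat s s (\<lambda>(l, j). cat_entry (\<theta> l) m (y j)))"

lemma cat_minor_in_homog_part: "cat_minor s \<theta> m y \<in> homog_part s"
  unfolding cat_minor_def by (rule det_in_homog_part) (auto intro: cat_entry_in_homog_part[unfolded One_nat_def])

lemma mpoly_eval_cat_minor:
  assumes "length m = length b" "\<And>j. j < s \<Longrightarrow> fst (y j) < length b"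
  shows "mpoly_eval (cat_minor s \<theta> m y) (pluecker b)
    = det (mat s s (\<lambda>(l, j). coef (\<theta> l \<lrcorner> cramer_vec b m (fst (y j))) (snd (y j))))"
proof -
  have "map_mat (\<lambda>p. mpoly_eval p (pluecker b)) (mat s s (\<lambda>(l, j). cat_entry (\<theta> l) m (y j)))
      = mat s s (\<lambda>(l, j). coef (\<theta> l \<lrcorner> cramer_vec b m (fst (y j))) (snd (y j)))"
    by (rule eq_matI) (auto simp: mpoly_eval_cat_entry[OF assms(1) assms(2)])
  then show ?thesis unfolding cat_minor_def mpoly_eval_det by simp
qed

lemma contract_lincomb_left: "(\<Sum>x\<in>X. pscale (a x) (f x)) \<lrcorner> F = (\<Sum>x\<in>X. pscale (a x) (f x \<lrcorner> F))"
proof -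
  have "pscale c \<theta> \<lrcorner> F = pscale c (\<theta> \<lrcorner> F)" for c and \<theta> :: "('a, 'b) mpoly"
    unfolding pscale_eq_mult contract_mult
    by (rule poly_mapping_eqI) (simp add: coef_contract_single lookup_pscale flip: pscale_eq_mult)
  then show ?thesis by (simp add: contract_sum_left)
qed

section \<open>Bounded catalecticant rank as a closed condition\<close>

text \<open>With \<open>s\<close> above the codimension of the annihilator, some nontrivial
  combination of the \<open>\<theta> l\<close> annihilates \<open>V\<close>. The Cramer vectors lie
  in \<open>V\<close>, so the rows of the matrix are dependent.\<close>

lemma cat_minor_vanishes:
  fixes b :: "('i::finite, 'k::field) dpoly list"
  assumes b: "pm.span (set b) = V" and h: "hilbert_fun (Ann V) e < s"
    and \<theta>: "\<And>l. l < s \<Longrightarrow> \<theta> l \<in> homog_part e"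
    and m: "length m = length b" and y: "\<And>j. j < s \<Longrightarrow> fst (y j) < length b"
  shows "mpoly_eval (cat_minor s \<theta> m y) (pluecker b) = 0"
proof -
  have sub: "pm.subspace (Ann V \<inter> homog_part e)"
    by (intro pm.subspace_inter subspace_Ann subspace_homog_part)
  obtain C where C: "quotient_basis (homog_part e) (Ann V \<inter> homog_part e) C" "finite C"
      "hilbert_fun (Ann V) e = card C"
    unfolding hilbert_fun_def by (rule fin_quotient_basis[OF fin_quotient_homog_part[OF subspace_Ann]])
  have "card C < card {..<s}" using h C(3) by simp
  then obtain a where a: "\<exists>l\<in>{..<s}. a l \<noteq> 0" "(\<Sum>l<s. pscale (a l) (\<theta> l)) \<in> Ann V \<inter> homog_part e"
    using many_vectors_dependent_mod[OF C(1,2) sub, of "{..<s}" \<theta>] \<theta> by auto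
  define N where "N = mat s s (\<lambda>(l, j). coef (\<theta> l \<lrcorner> cramer_vec b m (fst (y j))) (snd (y j)))"
  have N: "N \<in> carrier_mat s s" by (simp add: N_def)
  have "transpose_mat N *\<^sub>v vec s a = 0\<^sub>v s"
  proof (rule eq_vecI)
    fix j assume j: "j < dim_vec (0\<^sub>v s :: 'k vec)"
    have "cramer_vec b m (fst (y j)) \<in> V" using cramer_vec_in_span b by blast
    then have "(\<Sum>l<s. pscale (a l) (\<theta> l)) \<lrcorner> cramer_vec b m (fst (y j)) = 0" using a(2) by (auto simp: Ann_def)
    then have "(\<Sum>l<s. a l * coef (\<theta> l \<lrcorner> cramer_vec b m (fst (y j))) (snd (y j))) = 0"
      unfolding contract_lincomb_left using lookup_sum[of "\<lambda>l. pscale (a l) (\<theta> l \<lrcorner> cramer_vec b m (fst (y j)))" "{..<s}" "snd (y j)"]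
      by (simp add: lookup_pscale)
    then show "(transpose_mat N *\<^sub>v vec s a) $ j = 0\<^sub>v s $ j"
      using j by (simp add: scalar_prod_def N_def atLeast0LessThan mult.commute)
  qed (simp add: N_def)
  moreover have "vec s a \<noteq> 0\<^sub>v s" using a(1) by (metis index_vec index_zero_vec(1) lessThan_iff)
  ultimately have "det (transpose_mat N) = 0"
    using det_0_iff_vec_prod_zero_field[of "transpose_mat N" s] N vec_carrier[of s a]
    by (metis transpose_carrier_mat)
  then have "det N = 0" using det_transpose[OF N] by simp
  then show ?thesis using mpoly_eval_cat_minor[OF m, of s y \<theta>] y by (simp add: N_def)
qed

text \<open>Two applications of \<open>nonzero_minor_exists\<close>: the first finds
  \<open>m\<close> with a nonzero Pluecker coordinate, the second finds the columns \<open>y\<close>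
  for polynomials \<open>\<theta> l\<close> that are independent modulo
  \<open>Ann V\<close>.\<close>

lemma cat_minor_nonvanishing:
  fixes b :: "('i::finite, 'k::field) dpoly list"
  assumes b: "basis_list V b" and h: "s \<le> hilbert_fun (Ann V) e"
  obtains \<theta> m y where "\<And>l. l < s \<Longrightarrow> \<theta> l \<in> homog_part e" "length m = length b"
    "\<And>j. j < s \<Longrightarrow> fst (y j) < length b" "mpoly_eval (cat_minor s \<theta> m y) (pluecker b) \<noteq> 0"
proof -
  let ?k = "length b"
  have bb: "distinct b" "pm.independent (set b)" "pm.span (set b) = V" using b by (auto simp: basis_list_def)
  have "\<exists>cols. (\<forall>j<?k. cols j \<in> UNIV) \<and> det (mat ?k ?k (\<lambda>(l, j). coef (b ! l) (cols j))) \<noteq> 0"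
  proof (rule nonzero_minor_exists)
    fix a assume a: "\<And>x. x \<in> UNIV \<Longrightarrow> (\<Sum>l<?k. a l * coef (b ! l) x) = 0"
    have bij: "bij_betw ((!) b) {..<?k} (set b)" using bb(1) by (rule bij_betw_nth) auto
    define c where "c = (\<lambda>x. a (the_inv_into {..<?k} ((!) b) x))"
    have ca: "c (b ! l) = a l" if "l < ?k" for l
      unfolding c_def using bij that by (simp add: bij_betw_def the_inv_into_f_f)
    have "(\<Sum>x\<in>set b. pscale (c x) x) = (\<Sum>l<?k. pscale (c (b ! l)) (b ! l))"
      using sum.reindex_bij_betw[OF bij, of "\<lambda>x. pscale (c x) x"] by simp
    also have "\<dots> = 0"
      by (rule poly_mapping_eqI) (use a in \<open>simp add: lookup_sum lookup_pscale ca\<close>)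
    finally have "\<forall>x\<in>set b. c x = 0" using pm.dependent_finite[of "set b"] bb(2) by auto
    then show "\<forall>l<?k. a l = 0" using ca by (metis nth_mem)
  qed
  then obtain cols where cols: "det (mat ?k ?k (\<lambda>(l, j). coef (b ! l) (cols j))) \<noteq> 0" by blast
  define m where "m = map cols [0..<?k]"
  have m: "length m = ?k" by (simp add: m_def)
  have "minor_mat b m = mat ?k ?k (\<lambda>(l, j). coef (b ! l) (cols j))"
    by (rule eq_matI) (auto simp: minor_mat_def m_def)
  then have det: "det (minor_mat b m) \<noteq> 0" using cols by simp
  obtain C where C: "quotient_basis (homog_part e) (Ann V \<inter> homog_part e) C" "finite C"
      "hilbert_fun (Ann V) e = card C"
    unfolding hilbert_fun_def by (rule fin_quotient_basis[OF fin_quotient_homog_part[OF subspace_Ann]])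
  have C1: "C \<subseteq> homog_part e" "pm.independent C" "pm.span C \<inter> (Ann V \<inter> homog_part e) = {0}"
    using C(1) by (auto simp: quotient_basis_def)
  obtain \<theta> where \<theta>: "bij_betw \<theta> {0..<card C} C" using ex_bij_betw_nat_finite[OF C(2)] by blast
  have s: "s \<le> card C" using h C(3) by simp
  have \<theta>C: "\<theta> l \<in> C" if "l < s" for l using \<theta> that s by (auto simp: bij_betw_def)
  have \<theta>inj: "inj_on \<theta> {..<s}" using \<theta> s by (auto simp: bij_betw_def intro: inj_on_subset)
  let ?f = "\<lambda>l z. coef (\<theta> l \<lrcorner> cramer_vec b m (fst z)) (snd z)"
  have "\<exists>y. (\<forall>j<s. y j \<in> {z. fst z < ?k}) \<and> det (mat s s (\<lambda>(l, j). ?f l (y j))) \<noteq> 0"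
  proof (rule nonzero_minor_exists)
    fix a assume a: "\<And>z. z \<in> {z. fst z < ?k} \<Longrightarrow> (\<Sum>l<s. a l * ?f l z) = 0"
    let ?\<eta> = "\<Sum>l<s. pscale (a l) (\<theta> l)"
    have z: "?\<eta> \<lrcorner> cramer_vec b m i = 0" if "i < ?k" for i
    proof (rule poly_mapping_eqI)
      fix w
      show "coef (?\<eta> \<lrcorner> cramer_vec b m i) w = coef 0 w"
        unfolding contract_lincomb_left using a[of "(i, w)"] that by (simp add: lookup_sum lookup_pscale)
    qed
    \<comment> \<open>The nonzero Pluecker coordinate makes the Cramer vectors span
      \<open>V\<close>, so annihilating them is enough.\<close>
    have zb: "?\<eta> \<lrcorner> (b ! c) = 0" if c: "c < ?k" for c
    proof -
      have "pscale (det (minor_mat b m)) (?\<eta> \<lrcorner> (b ! c)) = ?\<eta> \<lrcorner> pscale (det (minor_mat b m)) (b ! c)"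
        by (simp add: contract_pscale_right)
      also have "\<dots> = 0"
        unfolding det_scale_eq_sum_cramer_vec[OF c] contract_sum_right contract_pscale_right by (simp add: z)
      finally show ?thesis using det by simp
    qed
    have "?\<eta> \<lrcorner> F = 0" if "F \<in> V" for F
    proof -
      have "pm.subspace {F. ?\<eta> \<lrcorner> F = 0}"
        by (auto simp: pm.subspace_def contract_add_right contract_pscale_right)
      moreover have "set b \<subseteq> {F. ?\<eta> \<lrcorner> F = 0}" using zb by (auto simp: in_set_conv_nth)
      ultimately show ?thesis using that bb(3) pm.span_minimal by blast
    qed
    then have "?\<eta> \<in> Ann V" by (simp add: Ann_def)
    moreover have sp: "?\<eta> \<in> pm.span C" by (intro pm.span_sum pm.span_scale pm.span_base) (simp add: \<theta>C)
    moreover have "?\<eta> \<in> homog_part e" using sp C1(1) pm.span_minimal[OF _ subspace_homog_part] by blast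
    ultimately have e0: "?\<eta> = 0" using C1(3) by blast
    define c where "c = (\<lambda>x. a (the_inv_into {..<s} \<theta> x))"
    have ca: "c (\<theta> l) = a l" if "l < s" for l
      unfolding c_def using \<theta>inj that by (simp add: the_inv_into_f_f)
    have "(\<Sum>x\<in>\<theta> ` {..<s}. pscale (c x) x) = ?\<eta>"
      by (simp add: sum.reindex[OF \<theta>inj] ca)
    moreover have "pm.independent (\<theta> ` {..<s})" using \<theta>C by (intro pm.independent_mono[OF C1(2)]) auto
    ultimately have "\<forall>x\<in>\<theta> ` {..<s}. c x = 0" using e0 pm.dependent_finite[of "\<theta> ` {..<s}"] by auto
    then show "\<forall>l<s. a l = 0" using ca by auto
  qed
  then obtain y where y: "\<forall>j<s. y j \<in> {z. fst z < ?k}" "det (mat s s (\<lambda>(l, j). ?f l (y j))) \<noteq> 0" by blast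
  have y1: "fst (y j) < ?k" if "j < s" for j using y(1) that by auto
  show ?thesis
  proof (rule that[of \<theta> m y])
    show "\<theta> l \<in> homog_part e" if "l < s" for l using \<theta>C[OF that] C1(1) by blast
    show "mpoly_eval (cat_minor s \<theta> m y) (pluecker b) \<noteq> 0"
      using y(2) mpoly_eval_cat_minor[OF m, of s y \<theta>] y1 by simp
  qed (use m y1 in auto)
qed

lemma basis_list_exists:
  fixes V :: "('i::finite, 'k::field) dpoly set"
  assumes "pm.subspace V" "V \<subseteq> homog_part d"
  obtains b where "basis_list V b"
proof -
  obtain B where B: "B \<subseteq> V" "pm.independent B" "V \<subseteq> pm.span B"
    by (rule pm.basis_exists[of V])
  have "finite B" using B assms(2) by (intro finite_independent_homog_part[of B d]) auto
  then obtain b where "set b = B" "distinct b" using finite_distinct_list by blast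
  moreover have "pm.span B = V" using B assms(1) by (metis pm.span_minimal subset_antisym)
  ultimately show ?thesis using that B(2) by (auto simp: basis_list_def)
qed

lemma length_basis_list: "basis_list V b \<Longrightarrow> length b = pm.dim V"
  unfolding basis_list_def by (metis distinct_card pm.dim_span_eq_card_independent)

text \<open>All catalecticant minors of size \<open>Suc r\<close> in degree \<open>e\<close> define
  a closed set that contains the subspaces of cactus rank at most \<open>r\<close>, but not
  \<open>V\<close>.\<close>

lemma not_in_grassmann_cactus_variety:
  fixes V :: "('i::finite, 'k::field) dpoly set"
  assumes V: "pm.subspace V" "V \<subseteq> homog_part d" and h: "r < hilbert_fun (Ann V) e"
  shows "V \<notin> grassmann_cactus_variety r (pm.dim V) d"
proof
  let ?k = "pm.dim V" and ?s = "Suc r"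
  define P where "P = {cat_minor ?s \<theta> m y | (\<theta> :: nat \<Rightarrow> ('i, 'k) mpoly) m y.
      (\<forall>l<?s. \<theta> l \<in> homog_part e) \<and> length m = ?k \<and> (\<forall>j<?s. fst (y j) < ?k)}"
  define Z where "Z = {V \<in> Gr ?k d. \<forall>b. basis_list V b \<longrightarrow> (\<forall>p\<in>P. mpoly_eval p (pluecker b) = 0)}"
  have "\<forall>p\<in>P. \<exists>e. p \<in> homog_part e" unfolding P_def using cat_minor_in_homog_part by blast
  then have closed: "Gr_closed ?k d Z" unfolding Gr_closed_def Z_def by blast
  have "{V' \<in> Gr ?k d. cactus_rank d V' \<le> enat r} \<subseteq> Z"
  proof
    fix V' :: "('i, 'k) dpoly set" assume "V' \<in> {V' \<in> Gr ?k d. cactus_rank d V' \<le> enat r}"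
    then have G: "V' \<in> Gr ?k d" "V' \<subseteq> homog_part d" "pm.dim V' = ?k" and "cactus_rank d V' \<le> enat r"
      by (auto simp: Gr_def)
    then have hs: "hilbert_fun (Ann V') e < ?s"
      using hilbert_fun_Ann_le_cactus_rank[of V' d r e] by simp
    have "mpoly_eval p (pluecker b) = 0" if b: "basis_list V' b" and p: "p \<in> P" for b p
    proof -
      have k: "length b = ?k" using length_basis_list[OF b] G(3) by simp
      have sp: "pm.span (set b) = V'" using b by (simp add: basis_list_def)
      obtain \<theta> m y where t: "p = cat_minor ?s \<theta> m y" "\<forall>l<?s. \<theta> l \<in> homog_part e" "length m = ?k"
        "\<forall>j<?s. fst (y j) < ?k" using p unfolding P_def by blast
      show ?thesis unfolding t(1) using t(2-4) k by (intro cat_minor_vanishes[OF sp hs]) auto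
    qed
    then show "V' \<in> Z" unfolding Z_def using G(1) by blast
  qed
  moreover assume "V \<in> grassmann_cactus_variety r ?k d"
  ultimately have VZ: "V \<in> Z" unfolding grassmann_cactus_variety_def Gr_closure_def using closed by blast
  obtain b where b: "basis_list V b" using basis_list_exists[OF V] .
  obtain \<theta> m y where t: "\<And>l. l < ?s \<Longrightarrow> \<theta> l \<in> homog_part e" "length m = length b"
    "\<And>j. j < ?s \<Longrightarrow> fst (y j) < length b" "mpoly_eval (cat_minor ?s \<theta> m y) (pluecker b) \<noteq> 0"
    using cat_minor_nonvanishing[OF b, of ?s e] h by (metis Suc_leI)
  have "cat_minor ?s \<theta> m y \<in> P" unfolding P_def using t(1-3) length_basis_list[OF b] by auto
  then show False using VZ b t(4) unfolding Z_def by blast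
qed

section \<open>Cactus rank and border cactus rank of the homogenization\<close>

lemma standard_fun_mono:
  assumes "standard_fun TYPE('i::finite) TYPE('k::field) s h" "e \<le> e'"
  shows "h e \<le> h e'"
proof -
  have "\<forall>e. h e \<le> h (e + 1)" using assms(1) unfolding standard_fun_def by blast
  then show ?thesis by (intro lift_Suc_mono_le[of h, OF _ assms(2)]) simp
qed

lemma standard_fun_le:
  assumes "standard_fun TYPE('i::finite) TYPE('k::field) s h"
  shows "h e \<le> s"
proof -
  have "h e \<le> min (pm.dim (homog_part e :: ('i, 'k) mpoly set)) s"
    using assms unfolding standard_fun_def by blast
  then show ?thesis by simp
qed

theorem theorem4p2:
  fixes W :: "('n::finite, 'k::alg_closed_field) dpoly set"
    and d1 d2 r :: nat
  assumes "d1 \<ge> 1"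
    and "pm.subspace W" and "W \<subseteq> deg_le_part d1" and "W \<noteq> {0}"
    and "r = quotient_dim UNIV (Ann W)"
  shows "cactus_rank (d1 + d2) (space_hom d1 d2 W) \<le> enat r
    \<and> (d2 \<ge> d1 \<longrightarrow>
         \<not> (\<exists>J. homogeneous_ideal J \<and> J \<subseteq> Ann (space_hom d1 d2 W) \<and>
              standard_fun TYPE('n option) TYPE('k) (r - 1) (hilbert_fun J))
         \<and> border_cactus_rank (d1 + d2) (space_hom d1 d2 W) = enat r)
    \<and> (d2 \<ge> d1 + 1 \<longrightarrow>
         (\<forall>J. homogeneous_ideal J \<and> J \<subseteq> Ann (space_hom d1 d2 W) \<and>
              standard_fun TYPE('n option) TYPE('k) r (hilbert_fun J)
            \<longrightarrow> saturation J = ideal_hom (Ann W)))"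
proof -
  note W = assms(3)
  let ?d = "d1 + d2"
  define V where "V = homogenize ?d ` W"
  have VW: "space_hom d1 d2 W = V" unfolding V_def by (rule space_hom_eq_image[OF W])
  have Vd: "V \<subseteq> homog_part ?d" unfolding V_def using homogenize_in_homog_part by blast
  interpret hom: Vector_Spaces.linear pscale pscale "homogenize ?d :: ('n, 'k) dpoly \<Rightarrow> _"
    by (rule linear_homogenize)
  have Vsub: "pm.subspace V" unfolding V_def by (rule hom.subspace_image[OF assms(2)])
  let ?I = "hom_of (Ann W)"
  have rpos: "0 < r" using quotient_dim_Ann_pos[OF W assms(2,4)] assms(5) by simp
  \<comment> \<open>Part (i): the Hilbert function is constantly \<open>r\<close> from degree
    \<open>d1\<close> on.\<close>
  have "zero_dim_scheme r ?I"
    unfolding zero_dim_scheme_def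
    using homogeneous_ideal_hom_of[OF is_ideal_Ann] saturation_hom_of[OF is_ideal_Ann] rpos
      hilbert_fun_hom_of_Ann[OF W] assms(5) by (intro conjI exI[of _ d1]) auto
  moreover have "V \<subseteq> veronese_span ?d ?I"
    by (rule subset_veronese_span[OF Vd]) (unfold V_def, rule hom_of_Ann_subset[OF W])
  ultimately have i: "cactus_rank ?d V \<le> enat r"
    unfolding cactus_rank_def using rpos by (intro Inf_lower) blast
  \<comment> \<open>Part (ii), decided in degree \<open>d1\<close>. Since \<open>0 < r\<close>, the
    bound \<open>r - 1\<close> is strictly below \<open>r\<close>.\<close>
  have ii_ideal: "\<not> standard_fun TYPE('n option) TYPE('k) (r - 1) (hilbert_fun J)"
    if "d1 \<le> d2" "homogeneous_ideal J" "J \<subseteq> Ann V" for J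
  proof
    assume "standard_fun TYPE('n option) TYPE('k) (r - 1) (hilbert_fun J)"
    then have "hilbert_fun J d1 \<le> r - 1" by (rule standard_fun_le)
    moreover have "r \<le> hilbert_fun J d1"
      using hilbert_fun_ge(1)[OF W, of J ?d d1] that assms(5) by (simp add: V_def homogeneous_ideal_def)
    ultimately show False using rpos by simp
  qed
  have ii_border: "border_cactus_rank ?d V = enat r" if "d1 \<le> d2"
  proof -
    have "V \<in> Gr (pm.dim V) ?d" using Vsub Vd by (simp add: Gr_def)
    \<comment> \<open>A closure contains the original set, so (i) yields the upper bound.\<close>
    then have "V \<in> grassmann_cactus_variety r (pm.dim V) ?d"
      unfolding grassmann_cactus_variety_def Gr_closure_def using i by blast
    moreover have "r \<le> s" if s: "V \<in> grassmann_cactus_variety s (pm.dim V) ?d" for s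
    proof (rule ccontr)
      assume "\<not> r \<le> s"
      moreover have "r \<le> hilbert_fun (Ann V) d1"
        \<comment> \<open>The ideal is taken to be \<open>Ann V\<close> itself.\<close>
        using hilbert_fun_ge(1)[OF W is_ideal_Ann order_refl, of d1 ?d] \<open>d1 \<le> d2\<close> assms(5)
        by (simp add: V_def)
      ultimately show False using not_in_grassmann_cactus_variety[OF Vsub Vd, of s d1] s by simp
    qed
    ultimately show ?thesis
      unfolding border_cactus_rank_def using rpos
      by (intro antisym Inf_lower Inf_greatest) auto
  qed
  have iii: "saturation J = ideal_hom (Ann W)"
    if d: "d1 + 1 \<le> d2" and J: "homogeneous_ideal J" "J \<subseteq> Ann V"
      and st: "standard_fun TYPE('n option) TYPE('k) r (hilbert_fun J)" for J
  proof -
    have iJ: "is_ideal J" using J(1) by (simp add: homogeneous_ideal_def)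
    have sI: "pm.subspace ?I" by (intro ideal_subspace is_ideal_hom_of is_ideal_Ann)
    have e0: "d1 \<le> Suc d1" "d1 + Suc d1 \<le> ?d" using d by auto
    have "hilbert_fun J (Suc d1) \<le> quotient_dim UNIV (Ann W)"
      using standard_fun_le[OF st] assms(5) by simp
    from hilbert_fun_ge(2)[OF W iJ J(2)[unfolded V_def] e0 this]
    have base: "J \<inter> homog_part (Suc d1) = ?I \<inter> homog_part (Suc d1)" .
    \<comment> \<open>One inclusion comes from generation by degree \<open>Suc d1\<close>; the
      dimension bound in the other direction from the monotonicity of standard functions.\<close>
    have "J \<inter> homog_part e = ?I \<inter> homog_part e" if e: "Suc d1 \<le> e" for e
    proof (rule hilbert_fun_antimono(2)[OF sI ideal_subspace[OF iJ]])
      show "?I \<inter> homog_part e \<subseteq> J" using base by (intro hom_of_Ann_generated[OF W iJ _ e]) blast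
      have "hilbert_fun ?I e = r" using hilbert_fun_hom_of_Ann[OF W, of e] e assms(5) by simp
      also have "r \<le> hilbert_fun J (Suc d1)"
        using hilbert_fun_ge(1)[OF W iJ J(2)[unfolded V_def] e0] assms(5) by simp
      also have "\<dots> \<le> hilbert_fun J e" by (rule standard_fun_mono[OF st e])
      finally show "hilbert_fun ?I e \<le> hilbert_fun J e" .
    qed
    then have "saturation J = ?I" by (rule saturation_eq_hom_of[OF is_ideal_Ann J(1)])
    then show ?thesis by (simp add: ideal_hom_eq_hom_of[OF is_ideal_Ann])
  qed
  show ?thesis unfolding VW using i ii_ideal ii_border iii by blast
qed

end
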